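(* Let $\mu_1,\dots,\mu_r>-1$ be such that $\mu_i-\mu_j\notin\mathbb Z$ if $i\neq j$. Let $\vec n,\vec m,\vec j,\vec k\in\mathbb N_0^r$ be such that $0\le|\vec j|\le|\vec n|/2$ and $0\le|\vec k|\le|\vec m|/2$, and let $\nu,\eta\in\{1,2\}$. Consider the Type II polynomial $\mathbf P^{\vec n}_{\vec j,\nu}$ on the disk and the Type I function $\mathbf Q^{\vec m}_{\vec k,\eta}$. Then $$I:=\int_D\mathbf P^{\vec n}_{\vec j,\nu}(\mathbf x)\,\mathbf Q^{\vec m}_{\vec k,\eta}(\mathbf x)\,d\mathbf x=0\qquad\text{if }\nu\ne\eta\ \text{ or }\ |\vec n|-2|\vec j|\ne|\vec m|-2|\vec k| .$$ Moreover, if $\nu=\eta$ and $|\vec n|-2|\vec j|=|\vec m|-2|\vec k|$, then $$I=\begin{cases}0&\text{if }\vec k\le\vec j\text{ (componentwise)},\\ 0&\text{if }|\vec j|\le|\vec k|-2,\\ \|Y_\nu^{|\vec n|-2|\vec j|}\|^2/2&\text{if }|\vec j|=|\vec k|-1.\end{cases}$$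
   Context: For a multi-index $\vec v=(v_1,\dots,v_r)\in\mathbb N_0^r$, $|\vec v|=v_1+\cdots+v_r$. $D=\{(x,y)\in\mathbb R^2:x^2+y^2\le1\}$ is the unit disk, with polar coordinates $x=\rho\cos\theta$, $y=\rho\sin\theta$, and $\mathbf x=(x,y)$. Write $\vec\mu=(\mu_1,\dots,\mu_r)$, and $W_l(x,y)=w_{\mu_l}(1-x^2-y^2)^{\mu_l}$ with $w_\mu=(\mu+1)/\pi$. Type II Jacobi–Piñeiro polynomials: for $M\in\mathbb N_0$, $\vec k\in\mathbb N_0^r$, and $\omega_l(t)=t^M(1-t)^{\mu_l}$ on $[0,1]$, they are given by the Rodrigues formula $$P^{(M,\vec\mu)}_{\vec k}(t)=\Big(\tfrac1{\omega_r(t)}\tfrac{d^{k_r}}{dt^{k_r}}\omega_r(t)(1-t)^{k_r}\Big)\cdots\Big(\tfrac1{\omega_1(t)}\tfrac{d^{k_1}}{dt^{k_1}}\omega_1(t)(1-t)^{k_1}\Big)t^{|\vec k|},$$ where each factor is the operator $f\mapsto\frac1{\omega_l}\frac{d^{k_l}}{dt^{k_l}}\big[\omega_l(1-t)^{k_l}f\big]$ applied to everything on its right. This polynomial has degree $|\vec k|$ and satisfies $\int_0^1P^{(M,\vec\mu)}_{\vec k}(t)\,t^s\,t^M(1-t)^{\mu_l}\,dt=0$ for $0\le s\le k_l-1$, $1\le l\le r$. Type I Jacobi–Piñeiro polynomials: $(A^{(M,\vec\mu)}_{\vec k,1},\dots,A^{(M,\vec\mu)}_{\vec k,r})$ is the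 vector of univariate polynomials with $\deg A^{(M,\vec\mu)}_{\vec k,l}\le k_l-1$ (so the $l$-th one is $0$ if $k_l=0$) and $$\sum_{l=1}^r \int_0^1A^{(M,\vec\mu)}_{\vec k,l}(t)\,t^s\,t^{M}(1-t)^{\mu_l}\,dt=\begin{cases}0&\text{if }0\le s\le|\vec k|-2,\\1&\text{if }s=|\vec k|-1.\end{cases}$$ For $M\in\mathbb N_0$ put $Y_1^M=\rho^M\cos(M\theta)$ and $Y_2^M=\rho^M\sin(M\theta)$, with squared norms on the unit circle $\|Y_1^M\|^2=\pi(1+\delta_{M,0})$, $\|Y_2^M\|^2=\pi$. With $M=|\vec n|-2|\vec j|$ the multiple orthogonal polynomials on the disk are $$\mathbf P^{\vec n}_{\vec j,\nu}=P^{(M,\vec\mu)}_{\vec j}(\rho^2)\,Y_\nu^M,\qquad \mathbf A^{\vec n}_{\vec j,\nu,(l)}=A^{(M,\vec\mu)}_{\vec j,l}(\rho^2)\,Y_\nu^M,\quad 1\le l\le r,$$ defined for $0\le|\vec j|\le|\vec n|/2$ if $\nu=1$ and for $0\le|\vec j|<|\vec n|/2$ if $\nu=2$ (and likewise for any other multi-indices in place of $\vec n,\vec j$). The Type I function is $\mathbf Q^{\vec n}_{\vec j,\nu}(\mathbf x)=\sum_{l=1}^r\mathbf A^{\vec n}_{\vec j,\nu,(l)}(\mathbf x)\,W_l(\mathbf x)$.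
   Formalization: With the stated normalizations the cases |j|≤|k|-2 and |j|=|k|-1 fail (r=1, μ=0, j=0, k=1: I=1, not π); they are proved with P made monic and W_l divided by w_{μ_l}. The other cases are also proved for the original I. For ν=2 or η=2 the inequality on |j| or |k| is strict. *)

theory Defs
  imports "HOL-Analysis.Analysis"
begin

text \<open>Vectors and multi-indices of length \<open>r\<close> are functions on \<^typ>\<open>nat\<close> of which only the values
  on \<open>{1..r}\<close> are used.\<close>

definition mi_size :: "nat \<Rightarrow> (nat \<Rightarrow> nat) \<Rightarrow> nat" where
  "mi_size r v = (\<Sum>l=1..r. v l)"


section \<open>Jacobi-Pineiro polynomials on \<open>[0,1]\<close>\<close>

definition jp_weight :: "nat \<Rightarrow> real \<Rightarrow> real \<Rightarrow> real" where
  "jp_weight M a t = t ^ M * (1 - t) powr a"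

definition jp_rodrigues_op :: "nat \<Rightarrow> real \<Rightarrow> nat \<Rightarrow> (real \<Rightarrow> real) \<Rightarrow> real \<Rightarrow> real" where
  "jp_rodrigues_op M a q f =
     (\<lambda>t. (deriv ^^ q) (\<lambda>u. jp_weight M a u * (1 - u) ^ q * f u) t / jp_weight M a t)"

text \<open>\<open>fold\<close> applies the operator with index \<open>1\<close> first, so it is the innermost one and the operator
  with index \<open>r\<close> is the outermost one.\<close>

definition jp_rodrigues :: "nat \<Rightarrow> (nat \<Rightarrow> real) \<Rightarrow> nat \<Rightarrow> (nat \<Rightarrow> nat) \<Rightarrow> real \<Rightarrow> real" where
  "jp_rodrigues r \<mu> M k =
     fold (\<lambda>l. jp_rodrigues_op M (\<mu> l) (k l)) [1..<r+1] (\<lambda>t. t ^ mi_size r k)"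

text \<open>The Rodrigues formula is meaningful on the open interval only, because the weights may vanish
  or be singular at the end points; it determines the polynomial.\<close>

definition jp_typeII :: "nat \<Rightarrow> (nat \<Rightarrow> real) \<Rightarrow> nat \<Rightarrow> (nat \<Rightarrow> nat) \<Rightarrow> real poly" where
  "jp_typeII r \<mu> M k = (THE p. \<forall>t\<in>{0<..<1}. poly p t = jp_rodrigues r \<mu> M k t)"

definition jp_typeII_monic :: "nat \<Rightarrow> (nat \<Rightarrow> real) \<Rightarrow> nat \<Rightarrow> (nat \<Rightarrow> nat) \<Rightarrow> real poly" where
  "jp_typeII_monic r \<mu> M k =
     smult (1 / lead_coeff (jp_typeII r \<mu> M k)) (jp_typeII r \<mu> M k)"

text \<open>\<open>s + 2 \<le> N\<close> and \<open>s + 1 = N\<close> stand for \<open>s \<le> N - 2\<close> and \<open>s = N - 1\<close> over the integers. The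
  components outside \<open>{1..r}\<close>, which carry no information, are set to \<open>0\<close>.\<close>

definition is_jp_typeI ::
    "nat \<Rightarrow> (nat \<Rightarrow> real) \<Rightarrow> nat \<Rightarrow> (nat \<Rightarrow> nat) \<Rightarrow> (nat \<Rightarrow> real poly) \<Rightarrow> bool" where
  "is_jp_typeI r \<mu> M k A \<longleftrightarrow>
     (\<forall>l. l \<notin> {1..r} \<longrightarrow> A l = 0) \<and>
     (\<forall>l\<in>{1..r}. if k l = 0 then A l = 0 else degree (A l) \<le> k l - 1) \<and>
     (\<forall>s. s + 2 \<le> mi_size r k \<longrightarrow>
        (\<Sum>l=1..r. LBINT t:{0..1}. poly (A l) t * t ^ s * jp_weight M (\<mu> l) t) = 0) \<and>
     (\<forall>s. s + 1 = mi_size r k \<longrightarrow>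
        (\<Sum>l=1..r. LBINT t:{0..1}. poly (A l) t * t ^ s * jp_weight M (\<mu> l) t) = 1)"

definition jp_typeI :: "nat \<Rightarrow> (nat \<Rightarrow> real) \<Rightarrow> nat \<Rightarrow> (nat \<Rightarrow> nat) \<Rightarrow> nat \<Rightarrow> real poly" where
  "jp_typeI r \<mu> M k = (THE A. is_jp_typeI r \<mu> M k A)"


section \<open>Multiple orthogonal polynomials on the unit disk\<close>

definition unit_disk :: "(real \<times> real) set" where
  "unit_disk = {(x, y). x\<^sup>2 + y\<^sup>2 \<le> 1}"

definition rho :: "real \<times> real \<Rightarrow> real" where
  "rho p = cmod (Complex (fst p) (snd p))"

definition theta :: "real \<times> real \<Rightarrow> real" where
  "theta p = Arg (Complex (fst p) (snd p))"

definition harmY :: "nat \<Rightarrow> nat \<Rightarrow> real \<times> real \<Rightarrow> real" where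
  "harmY \<nu> M p =
     (if \<nu> = 1 then rho p ^ M * cos (real M * theta p) else rho p ^ M * sin (real M * theta p))"

definition harmY_norm2 :: "nat \<Rightarrow> nat \<Rightarrow> real" where
  "harmY_norm2 \<nu> M = (LBINT t:{0..2*pi}. (harmY \<nu> M (cos t, sin t))\<^sup>2)"

lemma harmY_circle:
  "harmY \<nu> M (cos t, sin t) = (if \<nu> = 1 then cos (real M * t) else sin (real M * t))"
proof -
  let ?z = "Complex (cos t) (sin t)"
  have z: "?z = cis t" by (simp add: complex_eq_iff)
  have "cis (real M * Arg ?z) = cis (real M * t)"
    using Complex.DeMoivre[of "Arg ?z" M] Complex.DeMoivre[of t M] rcis_cmod_Arg[of ?z]
    by (simp add: z rcis_def)
  then have "cos (real M * Arg ?z) = cos (real M * t)" "sin (real M * Arg ?z) = sin (real M * t)"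
    by (simp_all add: complex_eq_iff)
  moreover have "cmod ?z = 1" by (simp add: z)
  ultimately show ?thesis by (simp add: harmY_def rho_def theta_def)
qed

lemma harmY_norm2_values:
  "harmY_norm2 1 M = pi * (if M = 0 then 2 else 1)"
  "M \<noteq> 0 \<Longrightarrow> harmY_norm2 2 M = pi"
proof -
  have c: "harmY_norm2 1 M = pi" and s: "harmY_norm2 2 M = pi" if M: "M \<noteq> 0"
  proof -
    let ?a = "real M"
    have d: "((\<lambda>t. t/2 + e * sin (2*?a*t) / (4*?a)) has_real_derivative (1/2 + e * cos (2*?a*t)/2)) (at t)"
      for t e :: real
      using M by (auto intro!: derivative_eq_intros simp: field_simps)
    have I: "(LBINT t:{0..2*pi}. (1/2 + e * cos (2*?a*t)/2)) = pi" for e :: real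
      using integral_FTC_Icc_real[OF _ d, of 0 "2*pi" e] sin_npi[of "4*M"]
      by (simp add: set_lebesgue_integral_def mult_ac)
    show "harmY_norm2 1 M = pi"
      using I[of 1] cos_squared_eq by (simp add: harmY_norm2_def harmY_circle cos_double_cos mult.assoc add_divide_distrib diff_divide_distrib)
    show "harmY_norm2 2 M = pi"
      using I[of "-1"] by (simp add: harmY_norm2_def harmY_circle cos_double_sin mult.assoc add_divide_distrib diff_divide_distrib)
  qed
  show "harmY_norm2 1 M = pi * (if M = 0 then 2 else 1)"
    using c by (cases "M = 0") (auto simp: harmY_norm2_def harmY_circle set_lebesgue_integral_def)
  show "M \<noteq> 0 \<Longrightarrow> harmY_norm2 2 M = pi" using s .
qed

definition w_const :: "real \<Rightarrow> real" where
  "w_const a = (a + 1) / pi"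

definition diskW :: "real \<Rightarrow> real \<times> real \<Rightarrow> real" where
  "diskW a p = w_const a * (1 - (fst p)\<^sup>2 - (snd p)\<^sup>2) powr a"

text \<open>The next five functions are meant for \<open>2 * mi_size r j \<le> mi_size r n\<close> if \<open>\<nu> = 1\<close>
  and for \<open>2 * mi_size r j < mi_size r n\<close> if \<open>\<nu> = 2\<close>.\<close>

definition diskP ::
    "nat \<Rightarrow> (nat \<Rightarrow> real) \<Rightarrow> (nat \<Rightarrow> nat) \<Rightarrow> (nat \<Rightarrow> nat) \<Rightarrow> nat \<Rightarrow> real \<times> real \<Rightarrow> real" where
  "diskP r \<mu> n j \<nu> p =
     (let M = mi_size r n - 2 * mi_size r j
      in poly (jp_typeII r \<mu> M j) ((rho p)\<^sup>2) * harmY \<nu> M p)"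

definition diskA ::
    "nat \<Rightarrow> (nat \<Rightarrow> real) \<Rightarrow> (nat \<Rightarrow> nat) \<Rightarrow> (nat \<Rightarrow> nat) \<Rightarrow> nat \<Rightarrow> nat \<Rightarrow> real \<times> real \<Rightarrow> real" where
  "diskA r \<mu> n j \<nu> l p =
     (let M = mi_size r n - 2 * mi_size r j
      in poly (jp_typeI r \<mu> M j l) ((rho p)\<^sup>2) * harmY \<nu> M p)"

definition diskQ ::
    "nat \<Rightarrow> (nat \<Rightarrow> real) \<Rightarrow> (nat \<Rightarrow> nat) \<Rightarrow> (nat \<Rightarrow> nat) \<Rightarrow> nat \<Rightarrow> real \<times> real \<Rightarrow> real" where
  "diskQ r \<mu> n j \<nu> p = (\<Sum>l=1..r. diskA r \<mu> n j \<nu> l p * diskW (\<mu> l) p)"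

text \<open>Biorthonormality needs compatible normalizations. The polynomials of the Rodrigues formula are
  not monic, and the moment conditions in \<^const>\<open>is_jp_typeI\<close> use the weights \<open>(1 - t) powr \<mu> l\<close>
  without the constants \<open>w_const (\<mu> l)\<close> that are part of \<^const>\<open>diskW\<close>. The following
  versions take the monic Type II polynomial and remove these constants.\<close>

definition diskP_monic ::
    "nat \<Rightarrow> (nat \<Rightarrow> real) \<Rightarrow> (nat \<Rightarrow> nat) \<Rightarrow> (nat \<Rightarrow> nat) \<Rightarrow> nat \<Rightarrow> real \<times> real \<Rightarrow> real" where
  "diskP_monic r \<mu> n j \<nu> p =
     (let M = mi_size r n - 2 * mi_size r j
      in poly (jp_typeII_monic r \<mu> M j) ((rho p)\<^sup>2) * harmY \<nu> M p)"

definition diskQ_normalized ::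
    "nat \<Rightarrow> (nat \<Rightarrow> real) \<Rightarrow> (nat \<Rightarrow> nat) \<Rightarrow> (nat \<Rightarrow> nat) \<Rightarrow> nat \<Rightarrow> real \<times> real \<Rightarrow> real" where
  "diskQ_normalized r \<mu> n j \<nu> p =
     (\<Sum>l=1..r. diskA r \<mu> n j \<nu> l p * (diskW (\<mu> l) p / w_const (\<mu> l)))"

end

theory Submission
  imports Defs
begin

text \<open>In polar coordinates the integrand is \<open>\<Phi>(\<rho>\<^sup>2)\<close> times a product of two harmonics, and everything
  reduces to \<open>\<integral>\<^sub>0\<^sup>1 t\<^sup>M P(t) \<Sum>\<^sub>l A\<^sub>l(t) (1 - t) powr \<mu>\<^sub>l dt\<close>. Substitute \<open>u = 1 - t\<close>. The Rodrigues operators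
  then multiply the coefficient of \<open>u ^ i\<close> by a product of factors \<open>\<alpha> + 1 + i\<close>, where \<open>\<alpha>\<close> runs over the
  exponents \<open>\<mu>\<^sub>l + s\<close>, \<open>s < k\<^sub>l\<close>. One such factor is the Euler operator
  \<open>g \<mapsto> (\<alpha> + 1) g + u g'\<close>, and integration by parts gives
  \<open>\<integral>\<^sub>0\<^sup>1 u powr \<beta> ((\<alpha> + 1) g + u g') du = g(1) + (\<alpha> - \<beta>) \<integral>\<^sub>0\<^sup>1 u powr \<beta> g du\<close>. Applied to a power of
  \<open>1 - u\<close>, Euler operators therefore produce both the orthogonality of the Type II polynomials and
  polynomials whose moments of order \<open>\<alpha>\<close> vanish at all exponents but one; the latter give the
  uniqueness of the Type I vector. Its existence comes from an explicit solution, verified with divided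
  differences.\<close>

section \<open>Euler operators and moments of polynomials\<close>

text \<open>\<open>euler_mult E\<close> is the composition of the Euler operators for \<open>\<alpha> \<in> E\<close>, and \<open>pow_moment \<beta> g\<close> is
  \<open>\<integral>\<^sub>0\<^sup>1 g(u) u powr \<beta> du\<close> when \<open>\<beta> > -1\<close>.\<close>

definition euler_mult :: "real set \<Rightarrow> real poly \<Rightarrow> real poly" where
  "euler_mult E g = (\<Sum>i\<le>degree g. monom ((\<Prod>\<alpha>\<in>E. \<alpha> + 1 + real i) * coeff g i) i)"

definition pow_moment :: "real \<Rightarrow> real poly \<Rightarrow> real" where
  "pow_moment \<beta> g = (\<Sum>i\<le>degree g. coeff g i / (real i + \<beta> + 1))"

lemma coeff_euler_mult: "coeff (euler_mult E g) i = (\<Prod>\<alpha>\<in>E. \<alpha> + 1 + real i) * coeff g i"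
  unfolding euler_mult_def coeff_sum coeff_monom
  by (cases "i \<le> degree g") (auto simp: coeff_eq_0 sum.delta)

lemma degree_euler_mult_le: "degree (euler_mult E g) \<le> degree g"
  by (rule degree_le) (auto simp: coeff_euler_mult coeff_eq_0)

text \<open>The leading coefficient is multiplied by a product of numbers
  \<open>\<alpha> + 1 + real (degree g)\<close>, all positive.\<close>

lemma degree_euler_mult:
  assumes "finite E" "\<And>\<alpha>. \<alpha> \<in> E \<Longrightarrow> -1 < \<alpha>"
  shows "degree (euler_mult E g) = degree g"
proof (cases "g = 0")
  case True
  then show ?thesis
    using degree_euler_mult_le[of E g] by simp
next
  case False
  have "(\<Prod>\<alpha>\<in>E. \<alpha> + 1 + real (degree g)) \<noteq> 0"
    using assms by (force simp: prod_zero_iff)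
  with False have "coeff (euler_mult E g) (degree g) \<noteq> 0"
    by (simp add: coeff_euler_mult)
  then have "degree g \<le> degree (euler_mult E g)"
    by (rule le_degree)
  with degree_euler_mult_le show ?thesis
    by (intro antisym)
qed

lemma euler_mult_empty [simp]: "euler_mult {} g = g"
  by (rule poly_eqI) (simp add: coeff_euler_mult)

text \<open>\<open>pCons 0\<close> is multiplication by u, so \<open>pCons 0 (pderiv h)\<close> has
  the coefficients \<open>i * coeff h i\<close>: adjoining \<open>\<alpha>\<close> means applying
  one more Euler operator.\<close>

lemma euler_mult_insert:
  assumes "finite E" "\<alpha> \<notin> E"
  shows "euler_mult (insert \<alpha> E) g
    = smult (\<alpha> + 1) (euler_mult E g) + pCons 0 (pderiv (euler_mult E g))"
proof (rule poly_eqI)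
  fix i
  show "coeff (euler_mult (insert \<alpha> E) g) i
      = coeff (smult (\<alpha> + 1) (euler_mult E g) + pCons 0 (pderiv (euler_mult E g))) i"
    using assms by (cases i) (simp_all add: coeff_euler_mult coeff_pderiv algebra_simps)
qed

text \<open>Differentiation lowers the order of the zero at u = 1 by at most one, hence so does an
  Euler operator.\<close>

lemma power_dvd_euler_step:
  fixes g :: "real poly"
  assumes "[:1, -1:] ^ Suc m dvd g"
  shows "[:1, -1:] ^ m dvd smult b g + pCons 0 (pderiv g)"
proof -
  let ?T = "[:1, -1:] :: real poly"
  obtain q where g: "g = ?T ^ Suc m * q"
    using assms by (auto elim: dvdE)
  have "?T ^ m dvd ?T ^ Suc m"
    by (rule le_imp_power_dvd) simp
  then have 1: "?T ^ m dvd g"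
    using assms dvd_trans by blast
  have "pderiv g = ?T ^ Suc m * pderiv q + ?T ^ m * (smult (of_nat (Suc m)) (pderiv ?T) * q)"
    unfolding g pderiv_mult pderiv_power_Suc by (simp add: algebra_simps)
  then have "?T ^ m dvd pderiv g"
    using \<open>?T ^ m dvd ?T ^ Suc m\<close> by (simp only: dvd_add dvd_mult2 dvd_triv_left)
  then have "?T ^ m dvd [:0, 1:] * pderiv g"
    by (rule dvd_mult)
  moreover have "pCons 0 (pderiv g) = [:0, 1:] * pderiv g"
    by simp
  ultimately have 2: "?T ^ m dvd pCons 0 (pderiv g)"
    by metis
  show ?thesis
    using 1 2 by (intro dvd_add dvd_smult)
qed

text \<open>Each of the \<open>card E\<close> operators costs at most one order. With m = 1 this
  removes boundary terms at u = 1; with m = M it makes a later division by t^M exact.\<close>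

lemma power_dvd_euler_mult:
  assumes "finite E" "[:1, -1:] ^ (m + card E) dvd g"
  shows "[:1, -1:] ^ m dvd euler_mult E g"
  using assms
proof (induction E arbitrary: m rule: finite_induct)
  case empty
  then show ?case by simp
next
  case (insert \<alpha> E)
  have "[:1, -1:] ^ Suc m dvd euler_mult E g"
    using insert.IH[of "Suc m"] insert.prems insert.hyps by simp
  then show ?case
    unfolding euler_mult_insert[OF insert.hyps(1,2)] by (rule power_dvd_euler_step)
qed

section \<open>Moments and integration by parts\<close>

lemma pow_moment_eq_sum:
  assumes "degree g \<le> n"
  shows "pow_moment \<beta> g = (\<Sum>i\<le>n. coeff g i / (real i + \<beta> + 1))"
  unfolding pow_moment_def using assms
  by (intro sum.mono_neutral_left) (auto simp: coeff_eq_0)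

lemma pow_moment_add: "pow_moment \<beta> (f + g) = pow_moment \<beta> f + pow_moment \<beta> g"
  using pow_moment_eq_sum[of f "max (degree f) (degree g)" \<beta>]
    pow_moment_eq_sum[of g "max (degree f) (degree g)" \<beta>]
    pow_moment_eq_sum[OF degree_add_le_max[of f g], of \<beta>]
  by (simp add: sum.distrib add_divide_distrib)

lemma pow_moment_smult: "pow_moment \<beta> (smult c f) = c * pow_moment \<beta> f"
  using pow_moment_eq_sum[of "smult c f" "degree f" \<beta>] 
  by (simp add: pow_moment_def sum_distrib_left)

lemma pow_moment_0 [simp]: "pow_moment \<beta> 0 = 0"
  by (simp add: pow_moment_def)

lemma pow_moment_sum: "pow_moment \<beta> (\<Sum>i\<in>S. f i) = (\<Sum>i\<in>S. pow_moment \<beta> (f i))"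
  by (induction S rule: infinite_finite_induct) (simp_all add: pow_moment_add)

text \<open>Multiplying by u^s raises the exponent of the weight by s. This turns integrals against
  polynomials into moments at shifted exponents.\<close>

lemma pow_moment_monom_mult: "pow_moment \<beta> (monom 1 s * g) = pow_moment (\<beta> + real s) g"
proof -
  have "pow_moment \<beta> (monom 1 s * g)
      = (\<Sum>i\<le>s + degree g. coeff (monom 1 s * g) i / (real i + \<beta> + 1))"
    by (rule pow_moment_eq_sum) (metis degree_monom_le degree_mult_le add_le_mono1 order_trans)
  also have "\<dots> = (\<Sum>i\<in>(+) s ` {..degree g}. coeff (monom 1 s * g) i / (real i + \<beta> + 1))"
  proof (rule sum.mono_neutral_right)
    show "\<forall>i\<in>{..s + degree g} - (+) s ` {..degree g}. coeff (monom 1 s * g) i / (real i + \<beta> + 1) = 0"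
    proof
      fix i assume i: "i \<in> {..s + degree g} - (+) s ` {..degree g}"
      have "i < s"
      proof (rule ccontr)
        assume "\<not> i < s"
        then have "i = s + (i - s)" "i - s \<le> degree g" using i by auto
        then show False using i by blast
      qed
      then show "coeff (monom 1 s * g) i / (real i + \<beta> + 1) = 0"
        by (simp add: coeff_monom_mult)
    qed
  qed auto
  also have "\<dots> = pow_moment (\<beta> + real s) g"
    by (subst sum.reindex) (auto simp: pow_moment_def coeff_monom_mult add_ac)
  finally show ?thesis .
qed

text \<open>This is integration by parts, done on coefficients: \<open>(\<alpha> + 1 + i) / (i +
  \<beta> + 1) = 1 + (\<alpha> - \<beta>) / (i + \<beta> + 1)\<close>, and the ones add up to the
  boundary term at u = 1, which vanishes by assumption.\<close>

lemma pow_moment_euler_mult_insert: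
  assumes "finite E" "\<alpha> \<notin> E" "-1 < \<beta>" "poly (euler_mult E g) 1 = 0"
  shows "pow_moment \<beta> (euler_mult (insert \<alpha> E) g) = (\<alpha> - \<beta>) * pow_moment \<beta> (euler_mult E g)"
proof -
  let ?h = "euler_mult E g" and ?n = "degree g"
  have "pow_moment \<beta> (euler_mult (insert \<alpha> E) g)
      = (\<Sum>i\<le>?n. (\<alpha> + 1 + real i) * coeff ?h i / (real i + \<beta> + 1))"
    using assms by (subst pow_moment_eq_sum[OF degree_euler_mult_le]) (simp add: coeff_euler_mult mult.assoc)
  also have "\<dots> = (\<Sum>i\<le>?n. coeff ?h i + (\<alpha> - \<beta>) * (coeff ?h i / (real i + \<beta> + 1)))"
  proof (rule sum.cong)
    fix i :: nat
    have "real i + \<beta> + 1 > 0" using assms(3) by linarith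
    then show "(\<alpha> + 1 + real i) * coeff ?h i / (real i + \<beta> + 1)
        = coeff ?h i + (\<alpha> - \<beta>) * (coeff ?h i / (real i + \<beta> + 1))"
      by (simp add: field_simps)
  qed simp
  also have "\<dots> = (\<Sum>i\<le>?n. coeff ?h i) + (\<alpha> - \<beta>) * pow_moment \<beta> ?h"
    by (simp add: sum.distrib sum_distrib_left pow_moment_eq_sum[OF degree_euler_mult_le])
  also have "(\<Sum>i\<le>?n. coeff ?h i) = poly ?h 1"
    unfolding poly_altdef using degree_euler_mult_le[of E g]
    by (auto intro!: sum.mono_neutral_right intro: le_degree)
  finally show ?thesis
    using assms(4) by simp
qed

text \<open>A zero of order \<open>card E\<close> at u = 1 kills the boundary term of every operator
  in turn. For \<open>\<beta> \<in> E\<close> the product contains the factor 0, which is the source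
  of the orthogonality.\<close>

lemma pow_moment_euler_mult:
  assumes "finite E" "-1 < \<beta>" "[:1, -1:] ^ card E dvd g"
  shows "pow_moment \<beta> (euler_mult E g) = (\<Prod>\<alpha>\<in>E. \<alpha> - \<beta>) * pow_moment \<beta> g"
  using assms(1,3)
proof (induction E rule: finite_induct)
  case empty
  then show ?case by simp
next
  case (insert \<alpha> E)
  from insert have d: "[:1, -1:] ^ Suc (card E) dvd g"
    by simp
  then have "[:1, -1:] ^ 1 dvd euler_mult E g"
    using insert.hyps by (intro power_dvd_euler_mult) auto
  then have "poly (euler_mult E g) 1 = 0"
    by (auto elim!: dvdE)
  moreover have "[:1, -1:] ^ card E dvd g"
    using d by (rule power_le_dvd) simp
  ultimately show ?case
    using insert by (simp add: pow_moment_euler_mult_insert assms)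
qed

text \<open>The Euler operator with \<open>\<alpha> = - K - 2\<close> maps \<open>(1 - u) ^ Suc K\<close> to a multiple of \<open>(1 - u) ^ K\<close>.\<close>

lemma pow_moment_one_minus_power:
  assumes "-1 < \<beta>"
  shows "pow_moment \<beta> ([:1, -1:] ^ K) = fact K / (\<Prod>i=1..Suc K. \<beta> + real i)"
proof (induction K)
  case 0
  then show ?case by (simp add: pow_moment_def add_ac)
next
  case (Suc K)
  let ?T = "[:1, -1:] :: real poly"
  let ?\<alpha> = "- real K - 2"
  have "pderiv (?T ^ Suc K) = smult (- real (Suc K)) (?T ^ K)"
    by (subst pderiv_power_Suc) (simp add: pderiv_pCons)
  then have "euler_mult {?\<alpha>} (?T ^ Suc K)
      = smult (?\<alpha> + 1) (?T ^ Suc K) + [:0, 1:] * smult (- real (Suc K)) (?T ^ K)"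
    using euler_mult_insert[of "{}" ?\<alpha> "?T ^ Suc K"] by simp
  \<comment> \<open>With \<open>?\<alpha> + 1 = - (K + 1)\<close> the two terms combine through (1 -
    u) + u = 1.\<close>
  moreover have "poly (smult (?\<alpha> + 1) (?T ^ Suc K) + [:0, 1:] * smult (- real (Suc K)) (?T ^ K))
      = poly (smult (- real (Suc K)) (?T ^ K))"
    by (rule ext) (simp add: algebra_simps)
  ultimately have "euler_mult {?\<alpha>} (?T ^ Suc K) = smult (- real (Suc K)) (?T ^ K)"
    by (simp only: poly_eq_poly_eq_iff)
  \<comment> \<open>The moment formula for this single operator is a recursion in K, with the factor
    \<open>?\<alpha> - \<beta> = - (\<beta> + K + 2)\<close>.\<close>
  then have "- real (Suc K) * pow_moment \<beta> (?T ^ K) = (?\<alpha> - \<beta>) * pow_moment \<beta> (?T ^ Suc K)"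
    using pow_moment_euler_mult[of "{?\<alpha>}" \<beta> "?T ^ Suc K"] assms
    by (simp add: pow_moment_smult del: power_Suc)
  moreover have "real K + 2 + \<beta> > 0"
    using assms by linarith
  ultimately have "pow_moment \<beta> (?T ^ Suc K)
      = real (Suc K) * pow_moment \<beta> (?T ^ K) / (\<beta> + real (Suc (Suc K)))"
    by (simp add: field_simps del: power_Suc)
  then show ?case
    by (simp add: Suc.IH mult.commute del: power_Suc)
qed

lemma pow_moment_one_minus_power_pos:
  assumes "-1 < \<beta>"
  shows "0 < pow_moment \<beta> ([:1, -1:] ^ K)"
  unfolding pow_moment_one_minus_power[OF assms]
  using assms by (intro divide_pos_pos prod_pos) auto

section \<open>Moments as integrals over [0,1]\<close>

lemma one_minus_powr_integral:
  fixes a :: real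
  assumes "-1 < a"
  shows "has_bochner_integral lborel (\<lambda>t. indicator {0..1} t * (1 - t) powr a) (1 / (a + 1))"
proof -
  have "((\<lambda>x. x powr a) has_integral 1 / (a + 1)) {0..1}"
    using has_integral_powr_from_0[of a 1] assms by simp
  then have "((\<lambda>x. indicator {0..1} x * x powr a) has_integral 1 / (a + 1)) UNIV"
    by (subst (asm) has_integral_restrict_UNIV [symmetric])
       (auto elim!: has_integral_eq[rotated] simp: indicator_def)
  then have "(\<integral>\<^sup>+x. ennreal (indicator {0..1} x * x powr a) \<partial>lborel) = ennreal (1 / (a + 1))"
    by (intro nn_integral_has_integral_lborel) auto
  then have 1: "has_bochner_integral lborel (\<lambda>x. indicator {0..1} x * x powr a) (1 / (a + 1))"
    using assms by (intro has_bochner_integral_nn_integral) auto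
  \<comment> \<open>The reflection x = 1 - t, written in the affine form that the substitution rule
    expects.\<close>
  have "has_bochner_integral lborel (\<lambda>t. indicator {0..1} (1 + (-1) * t) * (1 + (-1) * t) powr a) (1 / (a + 1))"
    using lborel_has_bochner_integral_real_affine_iff[of "-1" "\<lambda>x. indicator {0..1} x * x powr a" "1 / (a + 1)" 1] 1
    by simp
  then show ?thesis
    by (rule has_bochner_integral_cong[THEN iffD1, rotated -1]) (auto simp: indicator_def)
qed

text \<open>The change of variable u = 1 - t: the coefficients of \<open>flip p\<close> are those of
  p in powers of 1 - t.\<close>

abbreviation flip :: "real poly \<Rightarrow> real poly" where
  "flip p \<equiv> pcompose p [:1, -1:]"

lemma flip_flip [simp]: "flip (flip p) = p"
  by (simp add: pcompose_assoc [symmetric] pcompose_pCons)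

text \<open>Expanding p in powers of 1 - t and integrating term by term links the algebraic
  \<open>pow_moment\<close> with integrals.\<close>

lemma one_minus_powr_poly_integral:
  assumes "-1 < \<beta>"
  shows "set_integrable lborel {0..1} (\<lambda>t. poly p t * (1 - t) powr \<beta>)"
    and "(LBINT t:{0..1}. poly p t * (1 - t) powr \<beta>) = pow_moment \<beta> (flip p)"
proof -
  let ?q = "flip p"
  have "has_bochner_integral lborel
      (\<lambda>t. \<Sum>i\<le>degree ?q. coeff ?q i * (indicator {0..1} t * (1 - t) powr (real i + \<beta>)))
      (\<Sum>i\<le>degree ?q. coeff ?q i * (1 / (real i + \<beta> + 1)))"
    using assms
    by (intro has_bochner_integral_sum has_bochner_integral_mult_right one_minus_powr_integral) auto
  also have "(\<Sum>i\<le>degree ?q. coeff ?q i * (1 / (real i + \<beta> + 1))) = pow_moment \<beta> ?q"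
    by (simp add: pow_moment_def)
  also have "(\<lambda>t. \<Sum>i\<le>degree ?q. coeff ?q i * (indicator {0..1} t * (1 - t) powr (real i + \<beta>)))
      = (\<lambda>t. indicator {0..1} t *\<^sub>R (poly p t * (1 - t) powr \<beta>))"
  proof
    fix t :: real
    have "poly p t = poly ?q (1 - t)"
      by (simp add: poly_pcompose)
    then have "poly p t = (\<Sum>i\<le>degree ?q. coeff ?q i * (1 - t) ^ i)"
      by (simp add: poly_altdef)
    \<comment> \<open>At t = 1 both sides are 0, even for i = 0, because
      \<open>0 powr x = 0\<close>; elsewhere the exponents add.\<close>
    moreover have "(1 - t) ^ i * (1 - t) powr \<beta> = (1 - t) powr (real i + \<beta>)" if "t \<in> {0..1}" for i
      using that by (cases "t = 1") (auto simp: powr_add powr_realpow)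
    ultimately show "(\<Sum>i\<le>degree ?q. coeff ?q i * (indicator {0..1} t * (1 - t) powr (real i + \<beta>)))
        = indicator {0..1} t *\<^sub>R (poly p t * (1 - t) powr \<beta>)"
      by (auto simp: indicator_def sum_distrib_right mult.assoc)
  qed
  finally show "set_integrable lborel {0..1} (\<lambda>t. poly p t * (1 - t) powr \<beta>)"
      "(LBINT t:{0..1}. poly p t * (1 - t) powr \<beta>) = pow_moment \<beta> ?q"
    unfolding set_integrable_def set_lebesgue_integral_def
    by (auto simp: has_bochner_integral_iff)
qed

section \<open>Type II polynomials\<close>

text \<open>The closed forms of the Rodrigues iterates are established on (0,1) only, so iterated
  derivatives have to be compared on an open set.\<close>

lemma higher_deriv_cong_open:
  fixes f g :: "'a :: real_normed_field \<Rightarrow> 'a"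
  assumes "open S" "\<And>u. u \<in> S \<Longrightarrow> f u = g u" "t \<in> S"
  shows "(deriv ^^ q) f t = (deriv ^^ q) g t"
  using assms(3)
proof (induction q arbitrary: t)
  case 0
  then show ?case by (simp add: assms(2))
next
  case (Suc q)
  have "\<forall>\<^sub>F u in nhds t. (deriv ^^ q) f u = (deriv ^^ q) g u"
    using eventually_nhds_in_open[OF assms(1) Suc.prems] by (rule eventually_mono) (rule Suc.IH)
  then show ?case
    by (simp add: deriv_cong_ev)
qed

text \<open>Each derivative of (1 - u) powr b gives the factor -b; along the exponents from a + q +
  i down to a + 1 + i these multiply to a signed Pochhammer symbol.\<close>

lemma higher_deriv_one_minus_powr_sum:
  fixes a :: real
  assumes "t < 1"
  shows "(deriv ^^ q) (\<lambda>u. \<Sum>i\<le>n. c i * (1 - u) powr (a + real q + real i)) t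
    = (\<Sum>i\<le>n. (-1) ^ q * pochhammer (a + 1 + real i) q * c i * (1 - t) powr (a + real i))"
  using assms
proof (induction q arbitrary: a t)
  case 0
  then show ?case by simp
next
  case (Suc q)
  \<comment> \<open>The induction hypothesis is taken at a + 1, since a + Suc q = (a + 1) + q; one
    derivative then remains.\<close>
  have eq: "(deriv ^^ q) (\<lambda>u. \<Sum>i\<le>n. c i * (1 - u) powr (a + real (Suc q) + real i)) u
      = (\<Sum>i\<le>n. (-1) ^ q * pochhammer (a + 2 + real i) q * c i * (1 - u) powr (a + 1 + real i))"
    if "u < 1" for u
    using Suc.IH[OF that, of "a + 1"] by (simp add: add_ac)
  have "((\<lambda>u. \<Sum>i\<le>n. (-1) ^ q * pochhammer (a + 2 + real i) q * c i * (1 - u) powr (a + 1 + real i))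
      has_real_derivative
      (\<Sum>i\<le>n. (-1) ^ q * pochhammer (a + 2 + real i) q * c i
         * (- (a + 1 + real i) * (1 - t) powr (a + 1 + real i - 1)))) (at t)"
    using Suc.prems
    by (auto intro!: derivative_eq_intros sum.cong simp: powr_diff field_simps)
  then have "deriv (\<lambda>u. \<Sum>i\<le>n. (-1) ^ q * pochhammer (a + 2 + real i) q * c i * (1 - u) powr (a + 1 + real i)) t
      = (\<Sum>i\<le>n. (-1) ^ q * pochhammer (a + 2 + real i) q * c i
         * (- (a + 1 + real i) * (1 - t) powr (a + 1 + real i - 1)))"
    by (rule DERIV_imp_deriv)
  also have "\<dots> = (\<Sum>i\<le>n. (-1) ^ Suc q * pochhammer (a + 1 + real i) (Suc q) * c i * (1 - t) powr (a + real i))"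
    by (intro sum.cong refl) (simp add: pochhammer_rec add_ac, simp add: algebra_simps)
  finally have *: "deriv (\<lambda>u. \<Sum>i\<le>n. (-1) ^ q * pochhammer (a + 2 + real i) q * c i * (1 - u) powr (a + 1 + real i)) t
      = (\<Sum>i\<le>n. (-1) ^ Suc q * pochhammer (a + 1 + real i) (Suc q) * c i * (1 - t) powr (a + real i))" .
  have "deriv ((deriv ^^ q) (\<lambda>u. \<Sum>i\<le>n. c i * (1 - u) powr (a + real (Suc q) + real i))) t
      = deriv (\<lambda>u. \<Sum>i\<le>n. (-1) ^ q * pochhammer (a + 2 + real i) q * c i * (1 - u) powr (a + 1 + real i)) t"
    using eventually_nhds_in_open[of "{..<1}" t] Suc.prems eq
    by (intro deriv_cong_ev refl) (auto elim!: eventually_mono)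
  with * show ?case
    by simp
qed

text \<open>Functions of the form (polynomial in 1 - t) / t^M are stable under the operator: the
  weight cancels t^M, and on powers of 1 - t the operator is diagonal.\<close>

lemma jp_rodrigues_op_eq:
  assumes "\<And>u. u \<in> {0<..<1} \<Longrightarrow> f u = (\<Sum>i\<le>n. c i * (1 - u) ^ i) / u ^ M" "t \<in> {0<..<1}"
  shows "jp_rodrigues_op M a q f t
    = (\<Sum>i\<le>n. ((-1) ^ q * pochhammer (a + 1 + real i) q * c i) * (1 - t) ^ i) / t ^ M"
proof -
  have "(deriv ^^ q) (\<lambda>u. jp_weight M a u * (1 - u) ^ q * f u) t
      = (deriv ^^ q) (\<lambda>u. \<Sum>i\<le>n. c i * (1 - u) powr (a + real q + real i)) t"
  proof (rule higher_deriv_cong_open)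
    fix u :: real assume u: "u \<in> {0<..<1}"
    then have "(1 - u) powr (a + real q + real i) = (1 - u) powr a * (1 - u) ^ q * (1 - u) ^ i" for i
      by (simp add: powr_add powr_realpow)
    then show "jp_weight M a u * (1 - u) ^ q * f u = (\<Sum>i\<le>n. c i * (1 - u) powr (a + real q + real i))"
      using u by (simp add: assms(1) jp_weight_def sum_distrib_left sum_divide_distrib mult_ac)
  qed (use assms(2) in auto)
  also have "\<dots> = (\<Sum>i\<le>n. (-1) ^ q * pochhammer (a + 1 + real i) q * c i * (1 - t) powr (a + real i))"
    using assms(2) by (intro higher_deriv_one_minus_powr_sum) auto
  also have "\<dots> = (1 - t) powr a * (\<Sum>i\<le>n. (-1) ^ q * pochhammer (a + 1 + real i) q * c i * (1 - t) ^ i)"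
    using assms(2) by (simp add: powr_add powr_realpow sum_distrib_left mult_ac)
  finally show ?thesis
    using assms(2) by (simp add: jp_rodrigues_op_def jp_weight_def)
qed

lemma fold_jp_rodrigues_op_eq:
  assumes "\<And>u. u \<in> {0<..<1} \<Longrightarrow> f u = (\<Sum>i\<le>n. c i * (1 - u) ^ i) / u ^ M" "t \<in> {0<..<1}"
  shows "fold (\<lambda>l. jp_rodrigues_op M (\<mu> l) (k l)) ls f t
    = (\<Sum>i\<le>n. ((\<Prod>l\<leftarrow>ls. (-1) ^ k l * pochhammer (\<mu> l + 1 + real i) (k l)) * c i) * (1 - t) ^ i) / t ^ M"
  using assms(1)
proof (induction ls arbitrary: f c)
  case Nil
  then show ?case using assms(2) by simp
next
  case (Cons l ls)
  have "fold (\<lambda>l. jp_rodrigues_op M (\<mu> l) (k l)) ls (jp_rodrigues_op M (\<mu> l) (k l) f) t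
    = (\<Sum>i\<le>n. ((\<Prod>l\<leftarrow>ls. (-1) ^ k l * pochhammer (\<mu> l + 1 + real i) (k l))
        * ((-1) ^ k l * pochhammer (\<mu> l + 1 + real i) (k l) * c i)) * (1 - t) ^ i) / t ^ M"
    by (rule Cons.IH) (rule jp_rodrigues_op_eq[OF Cons.prems])
  then show ?case
    by (simp add: mult_ac)
qed

lemma flip_monom: "flip (monom 1 M) = [:1, -1:] ^ M"
  by (simp add: poly_eq_poly_eq_iff [symmetric] fun_eq_iff poly_pcompose poly_monom)

lemma degree_one_minus_power: "degree ([:1, -1:] ^ N :: real poly) = N"
  by (simp add: degree_power_eq)

lemma flip_eq_iff [simp]: "flip p = flip q \<longleftrightarrow> p = q"
  by (metis flip_flip)

lemma degree_flip [simp]: "degree (flip p) = degree p"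
  by (simp add: degree_pcompose)

text \<open>Like A, \<open>flip A\<close> has degree below n, so only the exponents \<beta> + i with
  i < n occur. For n = 0 the assumption forces A = 0 and both sides vanish.\<close>

lemma pow_moment_flip_mult:
  assumes "A = 0 \<or> degree A < n"
  shows "pow_moment \<beta> (flip A * h) = (\<Sum>i<n. coeff (flip A) i * pow_moment (\<beta> + real i) h)"
proof (cases n)
  case 0
  with assms show ?thesis by simp
next
  case (Suc n')
  with assms have "degree (flip A) \<le> n'"
    by auto
  then have "flip A = (\<Sum>i<n. smult (coeff (flip A) i) (monom 1 i))"
    by (simp add: smult_monom poly_as_sum_of_monoms' Suc lessThan_Suc_atMost)
  then have "flip A * h = (\<Sum>i<n. smult (coeff (flip A) i) (monom 1 i * h))"
    by (metis (no_types, lifting) mult_smult_left sum.cong sum_distrib_right)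
  then show ?thesis
    by (simp only: pow_moment_sum pow_moment_smult pow_moment_monom_mult)
qed

section \<open>Nodes and the explicit form of the Type II polynomials\<close>

locale jp_exponents =
  fixes r :: nat and \<mu> :: "nat \<Rightarrow> real"
  assumes exponent_gt: "\<And>l. l \<in> {1..r} \<Longrightarrow> \<mu> l > -1"
    and exponent_diff: "\<And>i l. \<lbrakk>i \<in> {1..r}; l \<in> {1..r}; i \<noteq> l\<rbrakk> \<Longrightarrow> \<mu> i - \<mu> l \<notin> \<int>"
begin

text \<open>The exponents of all functions (1 - t)^i (1 - t) powr \<mu> l with i < k l that enter
  the conditions for the multi-index k. Their Euler operators govern both types of
  polynomials.\<close>

definition nodes :: "(nat \<Rightarrow> nat) \<Rightarrow> real set" where
  "nodes k = (\<lambda>(l, i). \<mu> l + real i) ` (SIGMA l:{1..r}. {..<k l})"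

text \<open>A coincidence of two exponents would make a difference \<mu> l - \<mu> l' an integer.
  Hence there are exactly |k| nodes.\<close>

lemma inj_on_nodes: "inj_on (\<lambda>(l, i). \<mu> l + real i) (SIGMA l:{1..r}. {..<k l})"
proof (rule inj_onI, clarify)
  fix l i l' i'
  assume l: "l \<in> {1..r}" "l' \<in> {1..r}" and eq: "\<mu> l + real i = \<mu> l' + real i'"
  then have "\<mu> l - \<mu> l' = of_int (int i' - int i)"
    by simp
  then have "\<mu> l - \<mu> l' \<in> \<int>"
    by (metis Ints_of_int)
  then have "l = l'"
    using exponent_diff l by blast
  with eq show "l = l' \<and> i = i'"
    by simp
qed

lemma finite_nodes [simp]: "finite (nodes k)"
  by (simp add: nodes_def)

lemma card_nodes: "card (nodes k) = mi_size r k"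
  unfolding nodes_def mi_size_def by (subst card_image[OF inj_on_nodes]) (simp add: card_SigmaI)

lemma nodes_gt: "\<alpha> \<in> nodes k \<Longrightarrow> -1 < \<alpha>"
  using exponent_gt by (fastforce simp: nodes_def)

lemma sum_nodes: "(\<Sum>\<alpha>\<in>nodes k. f \<alpha>) = (\<Sum>l=1..r. \<Sum>i<k l. f (\<mu> l + real i))"
  unfolding nodes_def by (subst sum.reindex[OF inj_on_nodes]) (simp add: sum.Sigma case_prod_unfold)

text \<open>For fixed l the nodes are consecutive, so the Euler factors multiply to the Pochhammer
  symbols produced by the Rodrigues operators.\<close>

lemma prod_nodes: "(\<Prod>\<alpha>\<in>nodes k. \<alpha> + 1 + x) = (\<Prod>l=1..r. pochhammer (\<mu> l + 1 + x) (k l))"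
  unfolding nodes_def
  by (subst prod.reindex[OF inj_on_nodes])
     (simp add: prod.Sigma case_prod_unfold pochhammer_prod atLeast0LessThan add_ac)

text \<open>The start t^|k| is t^(M + |k|) / t^M, whose numerator is (1 - u)^(M + |k|) in u = 1 - t.
  The Rodrigues operators then act as Euler operators, with one sign per derivative.\<close>

lemma jp_rodrigues_eq:
  assumes "t \<in> {0<..<1}"
  shows "jp_rodrigues r \<mu> M k t
    = poly (smult ((-1) ^ mi_size r k) (euler_mult (nodes k) ([:1, -1:] ^ (M + mi_size r k)))) (1 - t) / t ^ M"
proof -
  let ?K = "mi_size r k"
  let ?N = "M + ?K"
  let ?c = "coeff ([:1, -1:] ^ ?N :: real poly)"
  have start: "u ^ ?K = (\<Sum>i\<le>?N. ?c i * (1 - u) ^ i) / u ^ M" if "u \<in> {0<..<1}" for u :: real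
  proof -
    have "(\<Sum>i\<le>?N. ?c i * (1 - u) ^ i) = poly ([:1, -1:] ^ ?N) (1 - u)"
      by (simp add: poly_altdef degree_one_minus_power del: poly_power)
    also have "\<dots> = u ^ ?N"
      by simp
    finally show ?thesis
      using that by (simp add: power_add)
  qed
  have signs: "(\<Prod>l\<leftarrow>[1..<r+1]. (-1) ^ k l * pochhammer (\<mu> l + 1 + real i) (k l))
      = (-1) ^ ?K * (\<Prod>\<alpha>\<in>nodes k. \<alpha> + 1 + real i)" for i
  proof -
    have "(\<Prod>l\<leftarrow>[1..<r+1]. (-1) ^ k l * pochhammer (\<mu> l + 1 + real i) (k l))
        = (\<Prod>l=1..r. (-1) ^ k l * pochhammer (\<mu> l + 1 + real i) (k l))"
      by (subst prod.distinct_set_conv_list [symmetric])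
         (simp_all only: set_upt distinct_upt Suc_eq_plus1 [symmetric] atLeastLessThanSuc_atLeastAtMost)
    then show ?thesis
      by (simp add: prod.distrib prod_nodes power_sum mi_size_def)
  qed
  have "jp_rodrigues r \<mu> M k t
      = (\<Sum>i\<le>?N. ((-1) ^ ?K * (\<Prod>\<alpha>\<in>nodes k. \<alpha> + 1 + real i) * ?c i) * (1 - t) ^ i) / t ^ M"
    unfolding jp_rodrigues_def
    by (subst fold_jp_rodrigues_op_eq[OF start assms])
       (simp_all only: signs)
  also have "(\<Sum>i\<le>?N. ((-1) ^ ?K * (\<Prod>\<alpha>\<in>nodes k. \<alpha> + 1 + real i) * ?c i) * (1 - t) ^ i)
      = poly (smult ((-1) ^ ?K) (euler_mult (nodes k) ([:1, -1:] ^ ?N))) (1 - t)"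
    by (simp add: poly_altdef degree_euler_mult nodes_gt degree_one_minus_power coeff_euler_mult
        sum_distrib_left mult_ac)
  finally show ?thesis .
qed

text \<open>The zero of order M + |k| at u = 1 keeps order at least M under the |k| Euler operators,
  so the quotient by t^M is a polynomial.\<close>

lemma jp_typeII_mult_monom:
  "monom 1 M * jp_typeII r \<mu> M k
    = flip (smult ((-1) ^ mi_size r k) (euler_mult (nodes k) ([:1, -1:] ^ (M + mi_size r k))))"
proof -
  let ?g = "smult ((-1) ^ mi_size r k) (euler_mult (nodes k) ([:1, -1:] ^ (M + mi_size r k)))"
  have "[:1, -1:] ^ M dvd ?g"
    by (intro dvd_smult power_dvd_euler_mult) (simp_all add: card_nodes)
  then obtain q where "?g = [:1, -1:] ^ M * q"
    by (elim dvdE)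
  then have p: "monom 1 M * flip q = flip ?g"
    by (simp add: pcompose_mult flip_monom [symmetric] pcompose_pCons)
  have val: "poly (flip q) t = jp_rodrigues r \<mu> M k t" if "t \<in> {0<..<1}" for t
  proof -
    have "t ^ M * poly (flip q) t = poly ?g (1 - t)"
      using arg_cong[OF p, of "\<lambda>p. poly p t"] by (simp only: poly_mult poly_monom) (simp add: poly_pcompose)
    then show ?thesis
      using that by (simp only: jp_rodrigues_eq[OF that]) (simp add: field_simps)
  qed
  have "jp_typeII r \<mu> M k = flip q"
    unfolding jp_typeII_def
  proof (rule the_equality)
    show "\<forall>t\<in>{0<..<1}. poly (flip q) t = jp_rodrigues r \<mu> M k t"
      using val by blast
    \<comment> \<open>Polynomials agreeing on the infinite set (0,1) are equal, so
      \<open>THE\<close> picks a unique polynomial.\<close>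
    fix p assume "\<forall>t\<in>{0<..<1}. poly p t = jp_rodrigues r \<mu> M k t"
    then have "{0<..<1} \<subseteq> {t. poly (p - flip q) t = 0}"
      using val by auto
    moreover have "infinite {0<..<1::real}"
      by (rule infinite_Ioo) simp
    ultimately have "infinite {t. poly (p - flip q) t = 0}"
      using infinite_super by blast
    then have "p - flip q = 0"
      using poly_roots_finite by blast
    then show "p = flip q"
      by simp
  qed
  with p show ?thesis
    by simp
qed

text \<open>All Euler factors at the top degree M + |k| are positive, so that degree survives;
  dividing by t^M leaves |k|.\<close>

lemma degree_jp_typeII: "degree (jp_typeII r \<mu> M k) = mi_size r k"
  and jp_typeII_nonzero: "jp_typeII r \<mu> M k \<noteq> 0"
proof -
  let ?p = "jp_typeII r \<mu> M k"
  let ?h = "euler_mult (nodes k) ([:1, -1:] ^ (M + mi_size r k))"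
  have d: "degree ?h = M + mi_size r k"
    by (simp add: degree_euler_mult nodes_gt degree_one_minus_power)
  have "coeff ?h (M + mi_size r k) \<noteq> 0"
  proof -
    have "(\<Prod>\<alpha>\<in>nodes k. \<alpha> + 1 + real (M + mi_size r k)) \<noteq> 0"
      using nodes_gt by (force simp: prod_zero_iff)
    moreover have "coeff ([:1, -1:] ^ (M + mi_size r k)) (M + mi_size r k) \<noteq> (0::real)"
      using leading_coeff_neq_0[of "[:1, -1:] ^ (M + mi_size r k) :: real poly"]
      by (simp add: degree_one_minus_power del: leading_coeff_neq_0 leading_coeff_0_iff)
    ultimately show ?thesis
      by (simp add: coeff_euler_mult)
  qed
  then have h0: "?h \<noteq> 0"
    by auto
  show nz: "?p \<noteq> 0"
  proof
    assume "?p = 0"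
    with jp_typeII_mult_monom[of M k] have "flip (smult ((-1) ^ mi_size r k) ?h) = flip 0"
      by simp
    then have "smult ((-1) ^ mi_size r k) ?h = 0"
      by (simp only: flip_eq_iff)
    with h0 show False by simp
  qed
  have "degree (monom 1 M * ?p) = M + mi_size r k"
    unfolding jp_typeII_mult_monom degree_flip by (simp add: d)
  then show "degree ?p = mi_size r k"
    using nz by (simp add: degree_mult_eq degree_monom_eq)
qed

text \<open>The product in the moment formula contains the factor \<alpha> - \<alpha>.\<close>

lemma pow_moment_euler_mult_nodes:
  assumes "\<alpha> \<in> nodes k"
  shows "pow_moment \<alpha> (euler_mult (nodes k) ([:1, -1:] ^ (M + mi_size r k))) = 0"
proof -
  have "[:1, -1:] ^ card (nodes k) dvd [:1, -1 :: real:] ^ (M + mi_size r k)"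
    by (rule le_imp_power_dvd) (simp add: card_nodes)
  then show ?thesis
    using assms nodes_gt[OF assms] by (simp add: pow_moment_euler_mult)
qed

text \<open>The moment of A t^M P unfolds into moments of t^M P at \<mu> l + i with i < k l, and all
  these exponents are nodes.\<close>

lemma jp_typeII_orthogonal:
  assumes "l \<in> {1..r}" "A = 0 \<or> degree A < k l"
  shows "pow_moment (\<mu> l) (flip (A * (monom 1 M * jp_typeII r \<mu> M k))) = 0"
proof -
  have "\<mu> l + real i \<in> nodes k" if "i < k l" for i
    using assms(1) that by (force simp: nodes_def)
  then show ?thesis
    by (simp add: pcompose_mult[of A] pow_moment_flip_mult[OF assms(2)] jp_typeII_mult_monom
        pow_moment_smult pow_moment_euler_mult_nodes)
qed

end

section \<open>Type I polynomials\<close>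

text \<open>Both sides are the top coefficient of the Lagrange interpolant of p at E, which equals p
  by the degree bound.\<close>

lemma sum_divided_difference:
  fixes p :: "'a :: field poly"
  assumes "finite E" "degree p < card E"
  shows "(\<Sum>\<alpha>\<in>E. poly p \<alpha> / (\<Prod>\<beta>\<in>E - {\<alpha>}. \<alpha> - \<beta>)) = coeff p (card E - 1)"
proof -
  define b where "b \<alpha> = (\<Prod>\<beta>\<in>E - {\<alpha>}. [:- \<beta>, 1:])" for \<alpha>
  define L where "L = (\<Sum>\<alpha>\<in>E. smult (poly p \<alpha> / (\<Prod>\<beta>\<in>E - {\<alpha>}. \<alpha> - \<beta>)) (b \<alpha>))"
  have deg: "degree (b \<alpha>) = card E - 1" and lead: "coeff (b \<alpha>) (card E - 1) = 1" if "\<alpha> \<in> E" for \<alpha>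
  proof -
    show d: "degree (b \<alpha>) = card E - 1"
      using that assms(1) by (simp add: b_def degree_prod_eq_sum_degree card_Diff_singleton)
    have "lead_coeff (b \<alpha>) = 1"
      unfolding b_def by (subst lead_coeff_prod) simp
    then show "coeff (b \<alpha>) (card E - 1) = 1"
      by (simp only: d)
  qed
  have L: "poly L \<gamma> = poly p \<gamma>" if "\<gamma> \<in> E" for \<gamma>
  proof -
    have "poly (b \<alpha>) \<gamma> = 0" if "\<alpha> \<in> E" "\<alpha> \<noteq> \<gamma>" for \<alpha>
      using that \<open>\<gamma> \<in> E\<close> assms(1) by (auto simp: b_def poly_prod prod_zero_iff)
    then have "poly L \<gamma> = (\<Sum>\<alpha>\<in>E. if \<alpha> = \<gamma> then poly p \<gamma> / (\<Prod>\<beta>\<in>E - {\<gamma>}. \<gamma> - \<beta>) * poly (b \<gamma>) \<gamma> else 0)"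
      by (auto simp: L_def poly_sum intro!: sum.cong)
    also have "\<dots> = poly p \<gamma> / (\<Prod>\<beta>\<in>E - {\<gamma>}. \<gamma> - \<beta>) * poly (b \<gamma>) \<gamma>"
      using that assms(1) by (simp add: sum.delta)
    also have "poly (b \<gamma>) \<gamma> = (\<Prod>\<beta>\<in>E - {\<gamma>}. \<gamma> - \<beta>)"
      by (simp add: b_def poly_prod)
    finally show ?thesis
      using assms(1) by (simp add: prod_zero_iff)
  qed
  have "degree L \<le> card E - 1"
    unfolding L_def using deg by (intro degree_sum_le) (auto intro: assms)
  then have "degree L < card E"
    using assms(2) by linarith
  then have "L = p"
    using L assms by (intro poly_eqI_degree[of E]) auto
  moreover have "coeff L (card E - 1) = (\<Sum>\<alpha>\<in>E. poly p \<alpha> / (\<Prod>\<beta>\<in>E - {\<alpha>}. \<alpha> - \<beta>))"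
    by (simp add: L_def coeff_sum lead del: One_nat_def)
  ultimately show ?thesis by simp
qed

text \<open>The coefficients are the residues at \<open>E\<close> of
  \<open>(x + 1) \<cdots> (x + M + N - 1) / (\<Prod>\<beta>\<in>E. x - \<beta>)\<close> up to a constant. For \<open>s = N - 1\<close> the moments contribute
  one more pole, at \<open>x0 = - (M + N)\<close>.\<close>

lemma ex_moment_coefficients:
  assumes "finite E" "\<And>\<alpha>. \<alpha> \<in> E \<Longrightarrow> -1 < \<alpha>"
  shows "\<exists>a. \<forall>s<card E. (\<Sum>\<alpha>\<in>E. a \<alpha> * pow_moment \<alpha> ([:1, -1:] ^ (s + M)))
    = (if s + 1 = card E then 1 else 0)"
proof (cases "E = {}")
  case True
  then show ?thesis by simp
next
  case False
  define N where "N = card E"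
  have N: "N \<ge> 1"
    using False assms(1) by (simp add: N_def Suc_le_eq card_gt_0_iff)
  define x0 where "x0 = - real (M + N)"
  define W where "W \<alpha> = (\<Prod>\<beta>\<in>E - {\<alpha>}. \<alpha> - \<beta>)" for \<alpha>
  \<comment> \<open>This constant makes the value at s = N - 1 equal to 1: there the factorial is (M
    + N - 1)! and the sum over E is minus the contribution of x0.\<close>
  define C where "C = - (\<Prod>\<beta>\<in>E. x0 - \<beta>) / fact (M + N - 1)"
  define a where "a \<alpha> = C * (\<Prod>i=1..M+N-1. \<alpha> + real i) / W \<alpha>" for \<alpha>
  have x0: "x0 - \<beta> \<noteq> 0" if "\<beta> \<in> E" for \<beta>
    using assms(2)[OF that] N unfolding x0_def by linarith
  have pos: "(\<Prod>i\<in>I. \<alpha> + real i) \<noteq> 0" if "\<alpha> \<in> E" "finite I" "0 \<notin> I" for \<alpha> I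
  proof -
    have "\<alpha> + real i > 0" if "i \<in> I" for i
    proof -
      have "i \<ge> 1" using that \<open>0 \<notin> I\<close> by (cases i) auto
      then have "real i \<ge> 1" by simp
      with assms(2)[OF \<open>\<alpha> \<in> E\<close>] show ?thesis by linarith
    qed
    then show ?thesis using that(2) by (force simp: prod_zero_iff)
  qed
  have "(\<Sum>\<alpha>\<in>E. a \<alpha> * pow_moment \<alpha> ([:1, -1:] ^ (s + M))) = (if s + 1 = N then 1 else 0)"
    if s: "s < N" for s
  proof (cases "s + 1 = N")
    case False
    \<comment> \<open>The moment cancels the factors i = 1, ..., s + M + 1 of the numerator of
      \<open>a\<close>; those in \<open>?I\<close> remain. Their product has degree N - 2 - s, too
      small for a nonzero divided difference over E.\<close>
    let ?I = "{s+M+2..M+N-1}"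
    let ?p = "\<Prod>i\<in>?I. [:real i, 1:]"
    have "degree ?p = N - 2 - s"
      using s by (simp add: degree_prod_eq_sum_degree)
    then have deg: "degree ?p < N - 1"
      using s False by linarith
    have "a \<alpha> * pow_moment \<alpha> ([:1, -1:] ^ (s + M)) = C * fact (s + M) * (poly ?p \<alpha> / W \<alpha>)"
      if "\<alpha> \<in> E" for \<alpha>
    proof -
      have "{1..M+N-1} = {1..Suc (s+M)} \<union> ?I"
        using s False by auto
      then have "(\<Prod>i=1..M+N-1. \<alpha> + real i) = (\<Prod>i=1..Suc (s+M). \<alpha> + real i) * (\<Prod>i\<in>?I. \<alpha> + real i)"
        by (simp only:) (subst prod.union_disjoint; auto)
      moreover have "(\<Prod>i\<in>?I. \<alpha> + real i) = poly ?p \<alpha>"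
        by (simp add: poly_prod add_ac)
      ultimately have "a \<alpha> = C * ((\<Prod>i=1..Suc (s+M). \<alpha> + real i) * poly ?p \<alpha>) / W \<alpha>"
        by (simp add: a_def)
      moreover have "(\<Prod>i=1..Suc (s+M). \<alpha> + real i) \<noteq> 0"
        using that by (intro pos) auto
      ultimately show ?thesis
        using assms(2)[OF that] by (simp add: pow_moment_one_minus_power del: prod.cl_ivl_Suc)
    qed
    then have "(\<Sum>\<alpha>\<in>E. a \<alpha> * pow_moment \<alpha> ([:1, -1:] ^ (s + M)))
        = C * fact (s + M) * (\<Sum>\<alpha>\<in>E. poly ?p \<alpha> / W \<alpha>)"
      by (simp add: sum_distrib_left)
    also have "(\<Sum>\<alpha>\<in>E. poly ?p \<alpha> / W \<alpha>) = coeff ?p (N - 1)"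
      unfolding W_def N_def using deg assms(1) by (intro sum_divided_difference) (auto simp: N_def)
    also have "\<dots> = 0"
      using deg by (rule coeff_eq_0)
    finally show ?thesis
      using False by simp
  next
    case True
    have "x0 \<notin> E"
      using x0 by force
    \<comment> \<open>The whole numerator cancels; the remaining factor \<alpha> + M + N = \<alpha>
      - x0 of the moment adds the node x0.\<close>
    have "a \<alpha> * pow_moment \<alpha> ([:1, -1:] ^ (s + M))
        = C * fact (s + M) * (1 / (\<Prod>\<beta>\<in>insert x0 E - {\<alpha>}. \<alpha> - \<beta>))"
      if "\<alpha> \<in> E" for \<alpha>
    proof -
      have M: "M + N - 1 = s + M" "M + N = Suc (s + M)"
        using True by auto
      have x0_eq: "insert x0 E - {\<alpha>} = insert x0 (E - {\<alpha>})"
        using that \<open>x0 \<notin> E\<close> by auto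
      have "(\<Prod>\<beta>\<in>insert x0 E - {\<alpha>}. \<alpha> - \<beta>) = (\<alpha> + real (Suc (s + M))) * W \<alpha>"
        unfolding x0_eq W_def using \<open>x0 \<notin> E\<close> assms(1) by (simp add: x0_def M)
      moreover have "(\<Prod>i=1..s+M. \<alpha> + real i) \<noteq> 0"
        using that by (intro pos) auto
      ultimately show ?thesis
        using assms(2)[OF that] unfolding a_def M(1)
        by (simp add: pow_moment_one_minus_power add_ac)
    qed
    then have "(\<Sum>\<alpha>\<in>E. a \<alpha> * pow_moment \<alpha> ([:1, -1:] ^ (s + M)))
        = C * fact (s + M) * (\<Sum>\<alpha>\<in>E. 1 / (\<Prod>\<beta>\<in>insert x0 E - {\<alpha>}. \<alpha> - \<beta>))"
      by (simp add: sum_distrib_left)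
    \<comment> \<open>Over the N + 1 points of \<open>insert x0 E\<close> the divided difference of
      the constant 1 is 0; the term at x0 moves to the right.\<close>
    also have "(\<Sum>\<alpha>\<in>E. 1 / (\<Prod>\<beta>\<in>insert x0 E - {\<alpha>}. \<alpha> - \<beta>)) = - 1 / (\<Prod>\<beta>\<in>E. x0 - \<beta>)"
      using sum_divided_difference[of "insert x0 E" 1] \<open>x0 \<notin> E\<close> assms(1) N False
      by (simp add: add_eq_0_iff2 del: of_bool_eq_0_iff)
    finally show ?thesis
      using True assms(1) x0 by (auto simp: C_def prod_zero_iff add.commute)
  qed
  then show ?thesis
    unfolding N_def by blast
qed

section \<open>Unique solvability of the Type I conditions\<close>

context jp_exponents
begin

text \<open>For components of admissible degree, the sum of the integrals of A l times h against the
  weights, as a linear functional of h in u = 1 - t. The unknowns are the |k| coefficients of the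
  \<open>flip (A l)\<close>, so the Type I conditions become a square linear system.\<close>

definition typeI_functional :: "(nat \<Rightarrow> nat) \<Rightarrow> (nat \<Rightarrow> real poly) \<Rightarrow> real poly \<Rightarrow> real" where
  "typeI_functional k A h
    = (\<Sum>l=1..r. \<Sum>i<k l. coeff (flip (A l)) i * pow_moment (\<mu> l + real i) h)"

lemma typeI_functional_integral:
  assumes "\<forall>l\<in>{1..r}. A l = 0 \<or> degree (A l) < k l"
  shows "(\<Sum>l=1..r. LBINT t:{0..1}. poly (A l) t * poly p t * jp_weight M (\<mu> l) t)
    = typeI_functional k A (flip p * [:1, -1:] ^ M)"
  unfolding typeI_functional_def
proof (rule sum.cong)
  fix l assume l: "l \<in> {1..r}"
  have "(LBINT t:{0..1}. poly (A l) t * poly p t * jp_weight M (\<mu> l) t)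
      = (LBINT t:{0..1}. poly (A l * (p * monom 1 M)) t * (1 - t) powr \<mu> l)"
    by (simp add: jp_weight_def poly_monom mult_ac)
  also have "\<dots> = pow_moment (\<mu> l) (flip (A l) * (flip p * [:1, -1:] ^ M))"
    using exponent_gt[OF l]
    by (simp only: one_minus_powr_poly_integral(2) pcompose_mult flip_monom)
  also have "\<dots> = (\<Sum>i<k l. coeff (flip (A l)) i * pow_moment (\<mu> l + real i) (flip p * [:1, -1:] ^ M))"
    using assms l by (intro pow_moment_flip_mult) auto
  finally show "(LBINT t:{0..1}. poly (A l) t * poly p t * jp_weight M (\<mu> l) t)
      = (\<Sum>i<k l. coeff (flip (A l)) i * pow_moment (\<mu> l + real i) (flip p * [:1, -1:] ^ M))" .
qed simp

lemma typeI_functional_add: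
  "typeI_functional k A (g + h) = typeI_functional k A g + typeI_functional k A h"
  by (simp add: typeI_functional_def pow_moment_add sum.distrib algebra_simps)

lemma typeI_functional_smult: "typeI_functional k A (smult c h) = c * typeI_functional k A h"
  by (simp add: typeI_functional_def pow_moment_smult sum_distrib_left mult_ac)

lemma typeI_functional_sum:
  "typeI_functional k A (\<Sum>s\<in>S. h s) = (\<Sum>s\<in>S. typeI_functional k A (h s))"
  by (induction S rule: infinite_finite_induct)
     (simp_all add: typeI_functional_add typeI_functional_def [of _ _ 0])

text \<open>The two moment clauses merge into one indexed by s < |k|, and "zero or of degree below
  \<open>k l\<close>" absorbs the case k l = 0.\<close>

lemma is_jp_typeI_iff:
  "is_jp_typeI r \<mu> M k A \<longleftrightarrow>
     (\<forall>l. l \<notin> {1..r} \<longrightarrow> A l = 0) \<and>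
     (\<forall>l\<in>{1..r}. A l = 0 \<or> degree (A l) < k l) \<and>
     (\<forall>s<mi_size r k. typeI_functional k A ([:1, -1:] ^ (s + M))
        = (if s + 1 = mi_size r k then 1 else 0))"
proof -
  have deg: "(if k l = 0 then A l = 0 else degree (A l) \<le> k l - 1) \<longleftrightarrow> A l = 0 \<or> degree (A l) < k l" for l
    by auto
  have mom: "(\<Sum>l=1..r. LBINT t:{0..1}. poly (A l) t * t ^ s * jp_weight M (\<mu> l) t)
      = typeI_functional k A ([:1, -1:] ^ (s + M))"
    if "\<forall>l\<in>{1..r}. A l = 0 \<or> degree (A l) < k l" for s
    using typeI_functional_integral[OF that, of "monom 1 s" M]
    by (simp add: poly_monom flip_monom power_add)
  have split: "(\<forall>s. s + 2 \<le> N \<longrightarrow> f s = 0) \<and> (\<forall>s. s + 1 = N \<longrightarrow> f s = 1)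
      \<longleftrightarrow> (\<forall>s<N. f s = (if s + 1 = N then 1 else 0))" for N and f :: "nat \<Rightarrow> real"
    by (auto simp: less_Suc_eq_le Suc_le_eq)
  show ?thesis
    unfolding is_jp_typeI_def deg using mom split[of "mi_size r k" "\<lambda>s. typeI_functional k A ([:1, -1:] ^ (s + M))"]
    by (auto simp only: conj_assoc)
qed

text \<open>When p is expanded in powers of t, only the power |k| - 1 contributes.\<close>

lemma typeI_functional_eq_coeff:
  assumes "is_jp_typeI r \<mu> M k A" "degree p < mi_size r k"
  shows "typeI_functional k A (flip p * [:1, -1:] ^ M) = coeff p (mi_size r k - 1)"
proof -
  let ?N = "mi_size r k"
  have N: "?N = Suc (?N - 1)" and d: "degree p \<le> ?N - 1"
    using assms(2) by simp_all
  have "p = (\<Sum>s\<le>?N - 1. monom (coeff p s) s)"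
    by (simp only: poly_as_sum_of_monoms'[OF d])
  also have "\<dots> = (\<Sum>s<?N. smult (coeff p s) (monom 1 s))"
    by (subst (2) N) (simp add: smult_monom lessThan_Suc_atMost)
  finally have "flip p = flip (\<Sum>s<?N. smult (coeff p s) (monom 1 s))"
    by simp
  then have "flip p * [:1, -1:] ^ M = (\<Sum>s<?N. smult (coeff p s) ([:1, -1:] ^ (s + M)))"
    by (simp only: pcompose_sum pcompose_smult flip_monom sum_distrib_right mult_smult_left power_add)
  then have "typeI_functional k A (flip p * [:1, -1:] ^ M)
      = (\<Sum>s<?N. coeff p s * typeI_functional k A ([:1, -1:] ^ (s + M)))"
    by (simp only: typeI_functional_sum typeI_functional_smult)
  also have "\<dots> = (\<Sum>s<?N. if s = ?N - 1 then coeff p s else 0)"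
    using assms(1) N by (intro sum.cong) (auto simp: is_jp_typeI_iff)
  also have "\<dots> = coeff p (?N - 1)"
    using assms(2) by (simp add: sum.delta)
  finally show ?thesis .
qed

text \<open>For each node a test polynomial \<open>?h\<close> isolates one coefficient: the Euler
  operators of all other nodes make its moments there vanish. The functional at \<open>?h\<close> is
  fixed by the Type I conditions, hence so is the coefficient.\<close>

lemma is_jp_typeI_unique:
  assumes A: "is_jp_typeI r \<mu> M k A" and B: "is_jp_typeI r \<mu> M k B"
  shows "A = B"
proof
  fix l
  show "A l = B l"
  proof (cases "l \<in> {1..r}")
    case False
    then show ?thesis using A B by (simp add: is_jp_typeI_iff)
  next
    case l: True
    have "coeff (flip (A l)) i = coeff (flip (B l)) i" for i
    proof (cases "i < k l")
      case False
      then have "coeff (flip (X l)) i = 0" if "is_jp_typeI r \<mu> M k X" for X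
        using that l by (cases "X l = 0") (auto simp: is_jp_typeI_iff intro!: coeff_eq_0)
      then show ?thesis using A B by simp
    next
      case i: True
      let ?N = "mi_size r k" and ?\<alpha> = "\<mu> l + real i"
      have \<alpha>: "?\<alpha> \<in> nodes k"
        using l i by (force simp: nodes_def)
      have card: "card (nodes k - {?\<alpha>}) = ?N - 1" and N: "?N > 0"
        unfolding card_nodes [symmetric] using \<alpha> by (auto simp: card_gt_0_iff)
      \<comment> \<open>The exponent exceeds the number of operators by M, so \<open>?h\<close> = (1
        - u)^M q; it corresponds to t^M p with p of degree below |k|.\<close>
      let ?h = "euler_mult (nodes k - {?\<alpha>}) ([:1, -1:] ^ (M + (?N - 1)))"
      have "[:1, -1:] ^ M dvd ?h"
        by (rule power_dvd_euler_mult) (simp_all add: card)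
      then obtain q where q: "?h = [:1, -1:] ^ M * q"
        by (elim dvdE)
      define p where "p = flip q"
      have qp: "?h = flip p * [:1, -1:] ^ M"
        by (simp only: q p_def flip_flip mult.commute)
      have "degree p < ?N"
      proof (cases "q = 0")
        case False
        have "degree ?h \<le> M + (?N - 1)"
          using degree_euler_mult_le by (metis degree_one_minus_power)
        then have "degree q \<le> ?N - 1"
          unfolding q using False by (simp add: degree_mult_eq degree_one_minus_power)
        then show ?thesis using N by (simp add: p_def)
      qed (use N in \<open>simp add: p_def\<close>)
      have dvd: "[:1, -1:] ^ card (nodes k - {?\<alpha>}) dvd [:1, -1 :: real:] ^ (M + (?N - 1))"
        by (rule le_imp_power_dvd) (simp add: card)
      have zero: "pow_moment \<beta> ?h = 0" if "\<beta> \<in> nodes k" "\<beta> \<noteq> ?\<alpha>" for \<beta>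
        using that nodes_gt[OF that(1)] dvd by (subst pow_moment_euler_mult) auto
      \<comment> \<open>The factors \<beta> - \<open>?\<alpha>\<close> over the other nodes are
        nonzero, and the moment of a power of 1 - u is positive.\<close>
      have nz: "pow_moment ?\<alpha> ?h \<noteq> 0"
        using nodes_gt[OF \<alpha>] dvd pow_moment_one_minus_power_pos[of ?\<alpha> "M + (?N - 1)"]
        by (subst pow_moment_euler_mult) (auto simp: prod_zero_iff)
      have "coeff (flip (X l)) i * pow_moment ?\<alpha> ?h = coeff p (?N - 1)"
        if X: "is_jp_typeI r \<mu> M k X" for X
      proof -
        have "typeI_functional k X ?h
            = (\<Sum>(l', i')\<in>(SIGMA l:{1..r}. {..<k l}). coeff (flip (X l')) i' * pow_moment (\<mu> l' + real i') ?h)"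
          by (simp add: typeI_functional_def sum.Sigma)
        also have "\<dots> = (\<Sum>(l', i')\<in>{(l, i)}. coeff (flip (X l')) i' * pow_moment (\<mu> l' + real i') ?h)"
        proof (rule sum.mono_neutral_right)
          show "\<forall>x\<in>(SIGMA l:{1..r}. {..<k l}) - {(l, i)}.
              (case x of (l', i') \<Rightarrow> coeff (flip (X l')) i' * pow_moment (\<mu> l' + real i') ?h) = 0"
          proof
            fix x assume x: "x \<in> (SIGMA l:{1..r}. {..<k l}) - {(l, i)}"
            obtain l' i' where x_eq: "x = (l', i')"
              by (cases x)
            from x have l': "l' \<in> {1..r}" "i' < k l'" and ne: "(l', i') \<noteq> (l, i)"
              by (auto simp: x_eq)
            then have "\<mu> l' + real i' \<noteq> ?\<alpha>"
              using inj_onD[OF inj_on_nodes[of k], of "(l', i')" "(l, i)"] l i by auto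
            moreover have "\<mu> l' + real i' \<in> nodes k"
              using l' by (force simp: nodes_def)
            ultimately have "pow_moment (\<mu> l' + real i') ?h = 0"
              by (rule zero[rotated])
            then show "(case x of (l', i') \<Rightarrow> coeff (flip (X l')) i' * pow_moment (\<mu> l' + real i') ?h) = 0"
              by (simp only: x_eq case_prod_conv mult_zero_right)
          qed
        qed (use l i in auto)
        finally have "coeff (flip (X l)) i * pow_moment ?\<alpha> ?h = typeI_functional k X ?h"
          by simp
        also have "\<dots> = coeff p (?N - 1)"
          unfolding qp by (rule typeI_functional_eq_coeff) fact+
        finally show ?thesis .
      qed
      from this[OF A] this[OF B] nz show ?thesis
        by (metis mult_right_cancel)
    qed
    then have "flip (A l) = flip (B l)"
      by (intro poly_eqI)
    then show ?thesis by simp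
  qed
qed

text \<open>A solution of the moment problem on the nodes is read as coefficients: its value at
  \<mu> l + i becomes the coefficient of u^i in the l-th component.\<close>

lemma is_jp_typeI_exists: "\<exists>A. is_jp_typeI r \<mu> M k A"
proof -
  obtain a where a: "\<And>s. s < mi_size r k \<Longrightarrow>
      (\<Sum>\<alpha>\<in>nodes k. a \<alpha> * pow_moment \<alpha> ([:1, -1:] ^ (s + M))) = (if s + 1 = mi_size r k then 1 else 0)"
    using ex_moment_coefficients[of "nodes k" M] nodes_gt card_nodes by auto
  define B where "B l = (\<Sum>i<k l. monom (a (\<mu> l + real i)) i)" for l
  have coeff_B: "coeff (B l) i = (if i < k l then a (\<mu> l + real i) else 0)" for l i
    by (simp add: B_def coeff_sum sum.delta)
  have deg_B: "B l = 0 \<or> degree (B l) < k l" for l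
    using coeff_B[of l "degree (B l)"] by (cases "B l = 0") (auto split: if_splits)
  \<comment> \<open>Components outside 1..r are 0, as \<open>is_jp_typeI\<close> prescribes.\<close>
  define A where "A l = (if l \<in> {1..r} then flip (B l) else 0)" for l
  have deg_A: "A l = 0 \<or> degree (A l) < k l" for l
    using deg_B[of l] by (auto simp: A_def)
  have "typeI_functional k A h = (\<Sum>\<alpha>\<in>nodes k. a \<alpha> * pow_moment \<alpha> h)" for h
    unfolding typeI_functional_def sum_nodes
    by (intro sum.cong) (auto simp: A_def coeff_B)
  then have "is_jp_typeI r \<mu> M k A"
    unfolding is_jp_typeI_iff using deg_A a A_def by (metis (full_types))
  then show ?thesis
    by blast
qed

lemma is_jp_typeI_jp_typeI: "is_jp_typeI r \<mu> M k (jp_typeI r \<mu> M k)"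
  unfolding jp_typeI_def
  using is_jp_typeI_exists is_jp_typeI_unique by (metis the_equality)

end

section \<open>Polar coordinates\<close>

text \<open>The angle is \<open>arctan s\<close>, which covers a half plane only, so the radius \<open>\<rho>\<close> ranges over all of
  \<open>\<real>\<close>.\<close>

lemma nn_integral_polar:
  fixes f :: "real \<times> real \<Rightarrow> ennreal"
  assumes [measurable]: "f \<in> borel_measurable borel"
  shows "(\<integral>\<^sup>+p. f p \<partial>lborel) = (\<integral>\<^sup>+s. \<integral>\<^sup>+\<rho>. ennreal (\<bar>\<rho>\<bar> / (1 + s\<^sup>2))
    * f (\<rho> / sqrt (1 + s\<^sup>2), s * \<rho> / sqrt (1 + s\<^sup>2)) \<partial>lborel \<partial>lborel)"
proof -
  have [measurable]: "f \<in> borel_measurable (borel \<Otimes>\<^sub>M borel)"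
    using assms by (simp add: borel_prod)
  have "(\<integral>\<^sup>+p. f p \<partial>lborel) = (\<integral>\<^sup>+x. \<integral>\<^sup>+y. f (x, y) \<partial>lborel \<partial>lborel)"
    by (subst lborel_prod [symmetric], subst lborel.nn_integral_fst [symmetric]) auto
  also have "\<dots> = (\<integral>\<^sup>+x. \<integral>\<^sup>+s. ennreal \<bar>x\<bar> * f (x, s * x) \<partial>lborel \<partial>lborel)"
  \<comment> \<open>The substitution y = s x needs x \<noteq> 0, which excludes only a null
    set.\<close>
  proof (rule nn_integral_cong_AE, rule eventually_mono[OF AE_lborel_singleton[of 0]])
    fix x :: real assume x: "x \<noteq> 0"
    have "(\<integral>\<^sup>+y. f (x, y) \<partial>lborel) = ennreal \<bar>x\<bar> * (\<integral>\<^sup>+s. f (x, 0 + x * s) \<partial>lborel)"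
      using x by (intro nn_integral_real_affine) auto
    also have "\<dots> = (\<integral>\<^sup>+s. ennreal \<bar>x\<bar> * f (x, s * x) \<partial>lborel)"
      by (subst nn_integral_cmult [symmetric]) (auto simp: mult.commute)
    finally show "(\<integral>\<^sup>+y. f (x, y) \<partial>lborel) = (\<integral>\<^sup>+s. ennreal \<bar>x\<bar> * f (x, s * x) \<partial>lborel)" .
  qed
  also have "\<dots> = (\<integral>\<^sup>+s. \<integral>\<^sup>+x. ennreal \<bar>x\<bar> * f (x, s * x) \<partial>lborel \<partial>lborel)"
    by (subst lborel_pair.Fubini') auto
  also have "\<dots> = (\<integral>\<^sup>+s. \<integral>\<^sup>+\<rho>. ennreal (\<bar>\<rho>\<bar> / (1 + s\<^sup>2))
    * f (\<rho> / sqrt (1 + s\<^sup>2), s * \<rho> / sqrt (1 + s\<^sup>2)) \<partial>lborel \<partial>lborel)"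
  proof (rule nn_integral_cong)
    fix s :: real
    have s: "1 + s\<^sup>2 > 0"
      by (rule add_pos_nonneg) auto
    \<comment> \<open>This is cos (arctan s). With x = c \<rho>, the factor |x| and the Jacobian c
      give |\<rho>| c^2.\<close>
    define c where "c = 1 / sqrt (1 + s\<^sup>2)"
    have c: "c > 0" "c * c = 1 / (1 + s\<^sup>2)"
      using s by (auto simp: c_def)
    have "(\<integral>\<^sup>+x. ennreal \<bar>x\<bar> * f (x, s * x) \<partial>lborel)
        = ennreal \<bar>c\<bar> * (\<integral>\<^sup>+\<rho>. ennreal \<bar>0 + c * \<rho>\<bar> * f (0 + c * \<rho>, s * (0 + c * \<rho>)) \<partial>lborel)"
      using c by (intro nn_integral_real_affine) auto
    also have "\<dots> = (\<integral>\<^sup>+\<rho>. ennreal \<bar>c\<bar> * (ennreal \<bar>0 + c * \<rho>\<bar> * f (0 + c * \<rho>, s * (0 + c * \<rho>))) \<partial>lborel)"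
      by (intro nn_integral_cmult [symmetric]) auto
    also have "\<dots> = (\<integral>\<^sup>+\<rho>. ennreal (\<bar>\<rho>\<bar> / (1 + s\<^sup>2))
        * f (\<rho> / sqrt (1 + s\<^sup>2), s * \<rho> / sqrt (1 + s\<^sup>2)) \<partial>lborel)"
    proof (rule nn_integral_cong)
      fix \<rho> :: real
      have "\<bar>c\<bar> * \<bar>0 + c * \<rho>\<bar> = \<bar>\<rho>\<bar> / (1 + s\<^sup>2)"
        using c by (simp add: abs_mult mult.assoc [symmetric])
      then have "ennreal \<bar>c\<bar> * ennreal \<bar>0 + c * \<rho>\<bar> = ennreal (\<bar>\<rho>\<bar> / (1 + s\<^sup>2))"
        by (simp only: ennreal_mult' [symmetric] abs_ge_zero)
      then show "ennreal \<bar>c\<bar> * (ennreal \<bar>0 + c * \<rho>\<bar> * f (0 + c * \<rho>, s * (0 + c * \<rho>)))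
          = ennreal (\<bar>\<rho>\<bar> / (1 + s\<^sup>2)) * f (\<rho> / sqrt (1 + s\<^sup>2), s * \<rho> / sqrt (1 + s\<^sup>2))"
        by (simp add: mult.assoc [symmetric]) (simp add: c_def)
    qed
    finally show "(\<integral>\<^sup>+x. ennreal \<bar>x\<bar> * f (x, s * x) \<partial>lborel) = (\<integral>\<^sup>+\<rho>. ennreal (\<bar>\<rho>\<bar> / (1 + s\<^sup>2))
        * f (\<rho> / sqrt (1 + s\<^sup>2), s * \<rho> / sqrt (1 + s\<^sup>2)) \<partial>lborel)" .
  qed
  finally show ?thesis .
qed

text \<open>As an equality of measures the substitution also applies to integrable functions of
  either sign.\<close>

lemma lborel_polar:
  "(lborel :: (real \<times> real) measure) =
    distr (density (lborel \<Otimes>\<^sub>M lborel) (\<lambda>(s, \<rho>). ennreal (\<bar>\<rho>\<bar> / (1 + s\<^sup>2)))) borel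
      (\<lambda>(s, \<rho>). (\<rho> / sqrt (1 + s\<^sup>2), s * \<rho> / sqrt (1 + s\<^sup>2)))" (is "_ = distr ?D _ ?T")
proof (rule measure_eqI)
  fix A :: "(real \<times> real) set" assume "A \<in> sets lborel"
  then have [measurable]: "A \<in> sets borel" by simp
  have T [measurable]: "?T \<in> borel_measurable (borel \<Otimes>\<^sub>M borel)"
    by (simp add: case_prod_unfold)
  have "emeasure lborel A = (\<integral>\<^sup>+p. indicator A p \<partial>lborel)"
    by simp
  also have "\<dots> = (\<integral>\<^sup>+s. \<integral>\<^sup>+\<rho>. ennreal (\<bar>\<rho>\<bar> / (1 + s\<^sup>2))
      * indicator A (\<rho> / sqrt (1 + s\<^sup>2), s * \<rho> / sqrt (1 + s\<^sup>2)) \<partial>lborel \<partial>lborel)"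
    by (rule nn_integral_polar) simp
  also have "\<dots> = (\<integral>\<^sup>+x. (case x of (s, \<rho>) \<Rightarrow> ennreal (\<bar>\<rho>\<bar> / (1 + s\<^sup>2))) * indicator A (?T x) \<partial>(lborel \<Otimes>\<^sub>M lborel))"
    by (subst lborel.nn_integral_fst [symmetric]) (simp_all add: case_prod_unfold)
  also have "\<dots> = (\<integral>\<^sup>+p. indicator A p \<partial>distr ?D borel ?T)"
    by (subst nn_integral_distr, simp, simp, subst nn_integral_density) (simp_all add: case_prod_unfold)
  finally show "emeasure lborel A = emeasure (distr ?D borel ?T) A"
    by simp
qed simp

lemma has_bochner_integral_product:
  fixes u v :: "real \<Rightarrow> real"
  assumes u: "has_bochner_integral lborel u a" and v: "has_bochner_integral lborel v b"
  shows "has_bochner_integral (lborel \<Otimes>\<^sub>M lborel) (\<lambda>(x, y). u x * v y) (a * b)"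
proof -
  have [measurable]: "u \<in> borel_measurable borel" "v \<in> borel_measurable borel"
    using u v by (auto dest: borel_measurable_has_bochner_integral)
  have iu: "integrable lborel u" and iv: "integrable lborel v"
    using u v by (auto simp: has_bochner_integral_iff)
  have int: "integrable (lborel \<Otimes>\<^sub>M lborel) (\<lambda>(x, y). u x * v y)"
    by (rule lborel_pair.Fubini_integrable) (use iu iv in \<open>auto simp: abs_mult\<close>)
  have "(\<integral>p. (case p of (x, y) \<Rightarrow> u x * v y) \<partial>(lborel \<Otimes>\<^sub>M lborel)) = (\<integral>x. \<integral>y. u x * v y \<partial>lborel \<partial>lborel)"
    using lborel_pair.integral_fst'[OF int] by simp
  also have "\<dots> = a * b"
    using u v by (simp add: has_bochner_integral_iff)
  finally show ?thesis
    using int by (simp add: has_bochner_integral_iff)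
qed

text \<open>After the substitution the integrand separates, with the Jacobian |\<rho>| / (1 + s^2)
  included in the two factors, and Fubini gives the product.\<close>

lemma has_bochner_integral_polar_product:
  fixes g :: "real \<times> real \<Rightarrow> real"
  assumes g [measurable]: "g \<in> borel_measurable borel"
    and split: "\<And>s \<rho>. g (\<rho> * cos (arctan s), \<rho> * sin (arctan s)) * \<bar>\<rho>\<bar> / (1 + s\<^sup>2) = u s * v \<rho>"
    and u: "has_bochner_integral lborel u a" and v: "has_bochner_integral lborel v b"
  shows "has_bochner_integral lborel g (a * b)"
proof -
  let ?T = "\<lambda>(s :: real, \<rho> :: real). (\<rho> / sqrt (1 + s\<^sup>2), s * \<rho> / sqrt (1 + s\<^sup>2))"
  let ?w = "\<lambda>(s :: real, \<rho> :: real). \<bar>\<rho>\<bar> / (1 + s\<^sup>2)"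
  have [measurable]: "?T \<in> borel_measurable (borel \<Otimes>\<^sub>M borel)"
    by (simp add: case_prod_unfold)
  have w [measurable]: "?w \<in> borel_measurable (borel \<Otimes>\<^sub>M borel)"
    by (simp add: case_prod_unfold)
  have w0: "0 \<le> ?w p" for p
    by (simp add: case_prod_unfold)
  have "(\<lambda>p. ?w p *\<^sub>R g (?T p)) = (\<lambda>(s, \<rho>). u s * v \<rho>)"
  proof (clarsimp simp: fun_eq_iff)
    fix s \<rho>
    show "\<bar>\<rho>\<bar> * g (\<rho> / sqrt (1 + s\<^sup>2), s * \<rho> / sqrt (1 + s\<^sup>2)) / (1 + s\<^sup>2) = u s * v \<rho>"
      using split[of \<rho> s] by (simp add: cos_arctan sin_arctan mult_ac)
  qed
  then have *: "has_bochner_integral (lborel \<Otimes>\<^sub>M lborel) (\<lambda>p. ?w p *\<^sub>R g (?T p)) (a * b)"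
    using has_bochner_integral_product[OF u v] by simp
  have "has_bochner_integral (density (lborel \<Otimes>\<^sub>M lborel) (\<lambda>p. ennreal (?w p))) (\<lambda>p. g (?T p)) (a * b)"
    by (rule has_bochner_integral_density[OF _ _ _ *]) (use w0 in auto)
  then have "has_bochner_integral (distr (density (lborel \<Otimes>\<^sub>M lborel) (\<lambda>p. ennreal (?w p))) borel ?T) g (a * b)"
    by (intro has_bochner_integral_distr) auto
  also have "distr (density (lborel \<Otimes>\<^sub>M lborel) (\<lambda>p. ennreal (?w p))) borel ?T = lborel"
    by (subst lborel_polar) (simp add: case_prod_unfold)
  finally show ?thesis .
qed

section \<open>Angular and radial integrals\<close>

definition angularY :: "nat \<Rightarrow> nat \<Rightarrow> real \<Rightarrow> real" where
  "angularY \<nu> M \<phi> = (if \<nu> = 1 then cos (real M * \<phi>) else sin (real M * \<phi>))"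

text \<open>The harmonics are the real and imaginary parts of (x + i y)^M. De Moivre's formula for
  \<open>rcis\<close> holds for radii of any sign, so negative \<rho> is covered.\<close>

lemma harmY_polar:
  "harmY \<nu> M (\<rho> * cos \<phi>, \<rho> * sin \<phi>) = \<rho> ^ M * angularY \<nu> M \<phi>"
  and harmY_Complex: "harmY \<nu> M (x, y) = (if \<nu> = 1 then Re (Complex x y ^ M) else Im (Complex x y ^ M))"
proof -
  show *: "harmY \<nu> M (x, y) = (if \<nu> = 1 then Re (Complex x y ^ M) else Im (Complex x y ^ M))" for x y
  proof -
    have "Complex x y ^ M = rcis (cmod (Complex x y) ^ M) (real M * Arg (Complex x y))"
      by (metis DeMoivre2 rcis_cmod_Arg)
    then show ?thesis
      by (simp add: harmY_def rho_def theta_def)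
  qed
  have "Complex (\<rho> * cos \<phi>) (\<rho> * sin \<phi>) = rcis \<rho> \<phi>"
    by (simp add: complex_eq_iff)
  then have "Complex (\<rho> * cos \<phi>) (\<rho> * sin \<phi>) ^ M = rcis (\<rho> ^ M) (real M * \<phi>)"
    by (simp only: DeMoivre2)
  then show "harmY \<nu> M (\<rho> * cos \<phi>, \<rho> * sin \<phi>) = \<rho> ^ M * angularY \<nu> M \<phi>"
    by (simp add: * angularY_def)
qed

text \<open>Substitution \<phi> = arctan s on the whole line. The bound on h gives integrability by
  comparison with 1 / (1 + s^2), and the continuity of H gives the limits at both ends.\<close>

lemma has_bochner_integral_arctan:
  fixes h H :: "real \<Rightarrow> real"
  assumes H: "\<And>\<phi>. (H has_real_derivative h \<phi>) (at \<phi>)" and h: "\<And>\<phi>. isCont h \<phi>" "\<And>\<phi>. \<bar>h \<phi>\<bar> \<le> 1"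
  shows "has_bochner_integral lborel (\<lambda>s. h (arctan s) / (1 + s\<^sup>2)) (H (pi / 2) - H (- pi / 2))"
proof -
  have pos: "1 + s\<^sup>2 > 0" for s :: real
    by (rule add_pos_nonneg) auto
  have nz: "1 + s\<^sup>2 \<noteq> 0" for s :: real
    using pos[of s] by simp
  have lim: "(((\<lambda>s. F (arctan s)) \<circ> real_of_ereal) \<longlongrightarrow> F (pi / 2)) (at_left \<infinity>)"
      "(((\<lambda>s. F (arctan s)) \<circ> real_of_ereal) \<longlongrightarrow> F (- pi / 2)) (at_right (-\<infinity>))"
    if "\<And>x. isCont F x" for F :: "real \<Rightarrow> real"
    using isCont_tendsto_compose[OF that tendsto_arctan_at_top] isCont_tendsto_compose[OF that tendsto_arctan_at_bot]
    by (simp_all add: ereal_tendsto_simps)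
  have "set_integrable lborel (einterval (-\<infinity>) \<infinity>) (\<lambda>s. 1 / (1 + s\<^sup>2))"
  proof (rule interval_integral_FTC_nonneg(1))
    show "((arctan \<circ> real_of_ereal) \<longlongrightarrow> - pi / 2) (at_right (-\<infinity>))"
      "((arctan \<circ> real_of_ereal) \<longlongrightarrow> pi / 2) (at_left \<infinity>)"
      using lim[of "\<lambda>x. x"] by (simp_all add: o_def)
    show "(arctan has_real_derivative 1 / (1 + s\<^sup>2)) (at s)" for s
      using DERIV_arctan[of s] by (simp add: inverse_eq_divide)
  qed (auto intro!: continuous_intros simp: nz pos less_imp_le)
  then have base: "integrable lborel (\<lambda>s::real. 1 / (1 + s\<^sup>2))"
    by (simp add: set_integrable_def)
  have cont: "isCont (\<lambda>s. h (arctan s) / (1 + s\<^sup>2)) s" for s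
    by (intro continuous_intros isCont_o2[OF _ h(1)] nz)
  then have [measurable]: "(\<lambda>s. h (arctan s) / (1 + s\<^sup>2)) \<in> borel_measurable borel"
    by (intro borel_measurable_continuous_onI) (simp add: continuous_on_eq_continuous_at)
  have int: "integrable lborel (\<lambda>s. h (arctan s) / (1 + s\<^sup>2))"
  proof (rule Bochner_Integration.integrable_bound[OF base])
    show "AE s in lborel. norm (h (arctan s) / (1 + s\<^sup>2)) \<le> norm (1 / (1 + s\<^sup>2))"
      using h(2) by (auto intro!: divide_right_mono simp: abs_divide)
  qed simp
  have "(LBINT s=-\<infinity>..\<infinity>. h (arctan s) / (1 + s\<^sup>2)) = H (pi / 2) - H (- pi / 2)"
  proof (rule interval_integral_FTC_integrable)
    fix s :: real
    show "((\<lambda>s. H (arctan s)) has_vector_derivative h (arctan s) / (1 + s\<^sup>2)) (at s)"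
      unfolding has_real_derivative_iff_has_vector_derivative [symmetric]
      using DERIV_chain2[OF H DERIV_arctan] by (simp add: divide_inverse)
    show "isCont (\<lambda>s. h (arctan s) / (1 + s\<^sup>2)) s"
      by (rule cont)
    show "set_integrable lborel (einterval (-\<infinity>) \<infinity>) (\<lambda>s. h (arctan s) / (1 + s\<^sup>2))"
      using int by (simp add: set_integrable_def)
    have "isCont H x" for x
      using H by (rule DERIV_isCont)
    from lim[OF this] show "(((\<lambda>s. H (arctan s)) \<circ> real_of_ereal) \<longlongrightarrow> H (- pi / 2)) (at_right (-\<infinity>))"
        "(((\<lambda>s. H (arctan s)) \<circ> real_of_ereal) \<longlongrightarrow> H (pi / 2)) (at_left \<infinity>)"
      by (simp_all add: o_def)
  qed simp
  then show ?thesis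
    using int by (simp add: has_bochner_integral_iff interval_lebesgue_integral_def set_lebesgue_integral_def)
qed

lemma has_bochner_integral_cos_arctan:
  "has_bochner_integral lborel (\<lambda>s. cos (a * arctan s) / (1 + s\<^sup>2)) (if a = 0 then pi else 2 * sin (a * pi / 2) / a)"
proof (cases "a = 0")
  case True
  then show ?thesis
    using has_bochner_integral_arctan[of "\<lambda>x. x" "\<lambda>_. 1"] by (auto intro!: derivative_eq_intros)
next
  case False
  have "has_bochner_integral lborel (\<lambda>s. cos (a * arctan s) / (1 + s\<^sup>2))
      (sin (a * (pi / 2)) / a - sin (a * (- pi / 2)) / a)"
    by (rule has_bochner_integral_arctan[of "\<lambda>x. sin (a * x) / a" "\<lambda>x. cos (a * x)"])
       (use False in \<open>auto intro!: derivative_eq_intros continuous_intros\<close>)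
  then show ?thesis
    using False by simp
qed

lemma has_bochner_integral_sin_arctan:
  "has_bochner_integral lborel (\<lambda>s. sin (a * arctan s) / (1 + s\<^sup>2)) 0"
proof (cases "a = 0")
  case True
  then show ?thesis by (simp add: has_bochner_integral_zero)
next
  case False
  have "has_bochner_integral lborel (\<lambda>s. sin (a * arctan s) / (1 + s\<^sup>2))
      (- cos (a * (pi / 2)) / a - - cos (a * (- pi / 2)) / a)"
    by (rule has_bochner_integral_arctan[of "\<lambda>x. - cos (a * x) / a" "\<lambda>x. sin (a * x)"])
       (use False in \<open>auto intro!: derivative_eq_intros continuous_intros\<close>)
  then show ?thesis
    by simp
qed

text \<open>Only a half circle is covered, so for M \<noteq> M' vanishing is claimed when M + M' is
  even; the odd case is left to the radial integral. Equal harmonics give half of the squared norm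
  on the full circle.\<close>

lemma has_bochner_integral_angular:
  fixes M M' \<nu> \<eta> :: nat
  assumes "\<nu> \<in> {1, 2}" "\<eta> \<in> {1, 2}" "\<nu> = 2 \<longrightarrow> M \<noteq> 0"
  obtains c where
    "has_bochner_integral lborel (\<lambda>s. angularY \<nu> M (arctan s) * angularY \<eta> M' (arctan s) / (1 + s\<^sup>2)) c"
    "\<nu> \<noteq> \<eta> \<or> (even (M + M') \<and> M \<noteq> M') \<longrightarrow> c = 0"
    "\<nu> = \<eta> \<and> M = M' \<longrightarrow> c = harmY_norm2 \<nu> M / 2"
proof -
  \<comment> \<open>The integral of cos (a \<phi>) over the half circle, which vanishes at nonzero
    even a. Product formulas reduce everything to the frequencies M - M' and M + M'.\<close>
  define C where "C a = (if a = 0 then pi else 2 * sin (a * pi / 2) / a)" for a :: real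
  let ?d = "real M - real M'" and ?e = "real M + real M'"
  note cosI = has_bochner_integral_cos_arctan[folded C_def]
  have C0: "C (real_of_int i) = 0" if "even i" "i \<noteq> 0" for i :: int
  proof -
    obtain j where "i = 2 * j" using \<open>even i\<close> by (elim evenE)
    then have "sin (real_of_int i * pi / 2) = 0"
      using sin_zero_iff_int2[of "real_of_int i * pi / 2"] by auto
    then show ?thesis using that by (simp add: C_def)
  qed
  have Cd: "C ?d = 0" if "even (M + M')" "M \<noteq> M'"
    using C0[of "int M - int M'"] that by simp
  have Ce: "C ?e = 0" if "even (M + M')" "M \<noteq> M' \<or> M \<noteq> 0"
    using C0[of "int M + int M'"] that by force
  have C_0: "C 0 = pi"
    by (simp add: C_def)
  consider "\<nu> = 1" "\<eta> = 1" | "\<nu> = 2" "\<eta> = 2" | "\<nu> = 1" "\<eta> = 2" | "\<nu> = 2" "\<eta> = 1"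
    using assms(1,2) by auto
  then show thesis
  proof cases
    case 1
    have "has_bochner_integral lborel (\<lambda>s. (cos (?d * arctan s) / (1 + s\<^sup>2) + cos (?e * arctan s) / (1 + s\<^sup>2)) / 2)
        ((C ?d + C ?e) / 2)"
      by (intro has_bochner_integral_divide has_bochner_integral_add cosI)
    also have "(\<lambda>s. (cos (?d * arctan s) / (1 + s\<^sup>2) + cos (?e * arctan s) / (1 + s\<^sup>2)) / 2)
        = (\<lambda>s. angularY \<nu> M (arctan s) * angularY \<eta> M' (arctan s) / (1 + s\<^sup>2))"
      using 1 by (auto simp: angularY_def cos_times_cos algebra_simps add_divide_distrib)
    finally show thesis
      using 1 Cd Ce by (intro that[of "(C ?d + C ?e) / 2"]) (auto simp: harmY_norm2_values C_0 simp del: One_nat_def)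
  next
    case 2
    have "has_bochner_integral lborel (\<lambda>s. (cos (?d * arctan s) / (1 + s\<^sup>2) - cos (?e * arctan s) / (1 + s\<^sup>2)) / 2)
        ((C ?d - C ?e) / 2)"
      by (intro has_bochner_integral_divide has_bochner_integral_diff cosI)
    also have "(\<lambda>s. (cos (?d * arctan s) / (1 + s\<^sup>2) - cos (?e * arctan s) / (1 + s\<^sup>2)) / 2)
        = (\<lambda>s. angularY \<nu> M (arctan s) * angularY \<eta> M' (arctan s) / (1 + s\<^sup>2))"
      using 2 by (auto simp: angularY_def sin_times_sin algebra_simps diff_divide_distrib)
    finally show thesis
      using 2 Cd Ce assms(3) by (intro that[of "(C ?d - C ?e) / 2"]) (auto simp: harmY_norm2_values C_0 simp del: One_nat_def)
  next
    case 3
    have "has_bochner_integral lborel (\<lambda>s. (sin (?e * arctan s) / (1 + s\<^sup>2) - sin (?d * arctan s) / (1 + s\<^sup>2)) / 2)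
        ((0 - 0) / 2)"
      by (intro has_bochner_integral_divide has_bochner_integral_diff has_bochner_integral_sin_arctan)
    also have "(\<lambda>s. (sin (?e * arctan s) / (1 + s\<^sup>2) - sin (?d * arctan s) / (1 + s\<^sup>2)) / 2)
        = (\<lambda>s. angularY \<nu> M (arctan s) * angularY \<eta> M' (arctan s) / (1 + s\<^sup>2))"
      using 3 by (auto simp: angularY_def cos_times_sin algebra_simps diff_divide_distrib)
    finally show thesis
      using 3 by (intro that[of 0]) auto
  next
    case 4
    have "has_bochner_integral lborel (\<lambda>s. (sin (?e * arctan s) / (1 + s\<^sup>2) + sin (?d * arctan s) / (1 + s\<^sup>2)) / 2)
        ((0 + 0) / 2)"
      by (intro has_bochner_integral_divide has_bochner_integral_add has_bochner_integral_sin_arctan)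
    also have "(\<lambda>s. (sin (?e * arctan s) / (1 + s\<^sup>2) + sin (?d * arctan s) / (1 + s\<^sup>2)) / 2)
        = (\<lambda>s. angularY \<nu> M (arctan s) * angularY \<eta> M' (arctan s) / (1 + s\<^sup>2))"
    proof -
      have "sin (real M * x) * cos (real M' * x) = (sin (?e * x) + sin (?d * x)) / 2" for x
        by (simp add: sin_times_cos distrib_right left_diff_distrib)
      then show ?thesis
        using 4 by (simp add: angularY_def add_divide_distrib, simp add: mult.commute)
    qed
    finally show thesis
      using 4 by (intro that[of 0]) auto
  qed
qed

text \<open>The integrand on [-1,1] has the parity of K. For odd K the halves cancel; for K = 2 M
  they add up to twice the integral over [0,1], and t = \<rho>^2 absorbs the factor 2.\<close>

lemma has_bochner_integral_radial:
  fixes \<Phi> :: "real \<Rightarrow> real"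
  assumes "set_integrable lborel {0..1} \<Phi>"
  obtains c where
    "has_bochner_integral lborel (\<lambda>\<rho>. \<bar>\<rho>\<bar> * \<rho> ^ K * (indicator {0..1} (\<rho>\<^sup>2) * \<Phi> (\<rho>\<^sup>2))) c"
    "odd K \<longrightarrow> c = 0"
    "\<forall>M. K = 2 * M \<longrightarrow> c = (LBINT t:{0..1}. t ^ M * \<Phi> t)"
proof -
  have sub: "set_integrable lborel {0..1} (\<lambda>\<rho>. f (\<rho>\<^sup>2) * (2 * \<rho>))"
      "(LBINT t:{0..1}. f t) = (LBINT \<rho>:{0..1}. f (\<rho>\<^sup>2) * (2 * \<rho>))"
    if "set_integrable lborel {0..1} f" for f :: "real \<Rightarrow> real"
  proof -
    have f: "set_integrable lborel {0\<^sup>2..1\<^sup>2} f" using that by simp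
    have d: "((\<lambda>\<rho>::real. \<rho>\<^sup>2) has_real_derivative 2 * x) (at x)" for x
      by (auto intro!: derivative_eq_intros)
    show "set_integrable lborel {0..1} (\<lambda>\<rho>. f (\<rho>\<^sup>2) * (2 * \<rho>))"
      by (rule integral_substitution(1)[OF f d]) (auto intro!: continuous_intros)
    have "(LBINT x. f x * indicator {0\<^sup>2..1\<^sup>2} x) = (LBINT x. f (x\<^sup>2) * (2 * x) * indicator {0..1} x)"
      by (rule integral_substitution(2)[OF f d]) (auto intro!: continuous_intros)
    then show "(LBINT t:{0..1}. f t) = (LBINT \<rho>:{0..1}. f (\<rho>\<^sup>2) * (2 * \<rho>))"
      by (simp add: set_lebesgue_integral_def mult.commute)
  qed
  \<comment> \<open>The integrand on the half \<rho> \<ge> 0, where |\<rho>| \<rho>^K is a single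
    power.\<close>
  define w where "w \<rho> = indicator {0..1} \<rho> * (\<rho> ^ Suc K * \<Phi> (\<rho>\<^sup>2))" for \<rho> :: real
  have int_mult: "integrable lborel (\<lambda>x. indicator {0..1} x * (x ^ n * g x))"
    if "set_integrable lborel {0..1} g" for n and g :: "real \<Rightarrow> real"
  proof -
    have g: "integrable lborel (\<lambda>x. indicator {0..1} x * g x)"
      using that by (simp add: set_integrable_def)
    have "integrable lborel (\<lambda>x. x ^ n * (indicator {0..1} x * g x))"
    proof (rule Bochner_Integration.integrable_bound[OF g])
      show "(\<lambda>x. x ^ n * (indicator {0..1} x * g x)) \<in> borel_measurable lborel"
        using borel_measurable_integrable[OF g] by (intro borel_measurable_times[where g = "\<lambda>x. indicator {0..1} x * g x"]) auto
      show "AE x in lborel. norm (x ^ n * (indicator {0..1} x * g x)) \<le> norm (indicator {0..1} x * g x)"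
        by (auto simp: indicator_def abs_mult power_abs intro!: mult_left_le_one_le power_le_one)
    qed
    then show ?thesis by (simp add: mult_ac)
  qed
  \<comment> \<open>The substitution makes \<Phi>(\<rho>^2) 2 \<rho> integrable; the factor
    \<rho>^K, bounded on [0,1], and halving give \<open>w\<close>.\<close>
  have "integrable lborel (\<lambda>\<rho>. indicator {0..1} \<rho> * (\<rho> ^ K * (\<Phi> (\<rho>\<^sup>2) * (2 * \<rho>))))"
    by (rule int_mult) (rule sub(1)[OF assms])
  then have "integrable lborel (\<lambda>\<rho>. (indicator {0..1} \<rho> * (\<rho> ^ K * (\<Phi> (\<rho>\<^sup>2) * (2 * \<rho>)))) / 2)"
    by (rule integrable_divide)
  also have "(\<lambda>\<rho>. (indicator {0..1} \<rho> * (\<rho> ^ K * (\<Phi> (\<rho>\<^sup>2) * (2 * \<rho>)))) / 2) = w"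
    by (auto simp: w_def)
  finally have w: "has_bochner_integral lborel w (LBINT \<rho>. w \<rho>)"
    by (simp add: has_bochner_integral_iff)
  then have w': "has_bochner_integral lborel (\<lambda>\<rho>. w (- \<rho>)) (LBINT \<rho>. w \<rho>)"
    using lborel_has_bochner_integral_real_affine_iff[of "-1" w "LBINT \<rho>. w \<rho>" 0] by simp
  have "has_bochner_integral lborel (\<lambda>\<rho>. w \<rho> + (-1) ^ K * w (- \<rho>)) ((LBINT \<rho>. w \<rho>) + (-1) ^ K * (LBINT \<rho>. w \<rho>))"
    by (intro has_bochner_integral_add has_bochner_integral_mult_right w w')
  also have "(\<lambda>\<rho>. w \<rho> + (-1) ^ K * w (- \<rho>)) = (\<lambda>\<rho>. \<bar>\<rho>\<bar> * \<rho> ^ K * (indicator {0..1} (\<rho>\<^sup>2) * \<Phi> (\<rho>\<^sup>2)))"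
  proof
    fix \<rho> :: real
    have "\<rho>\<^sup>2 \<le> 1 \<longleftrightarrow> \<bar>\<rho>\<bar> \<le> 1"
      by (simp add: abs_square_le_1)
    then have ind: "indicator {0..1} (\<rho>\<^sup>2) = (if -1 \<le> \<rho> \<and> \<rho> \<le> 1 then 1 else 0 :: real)"
      by (auto simp: indicator_def)
    show "w \<rho> + (-1) ^ K * w (- \<rho>) = \<bar>\<rho>\<bar> * \<rho> ^ K * (indicator {0..1} (\<rho>\<^sup>2) * \<Phi> (\<rho>\<^sup>2))"
    proof (cases "\<rho> < 0")
      case True
      have "(-1) ^ K * (- \<rho>) ^ K = \<rho> ^ K"
        by (simp flip: power_mult_distrib)
      then have "(-1) ^ K * w (- \<rho>) = indicator {0..1} (- \<rho>) * ((- \<rho>) * \<rho> ^ K * \<Phi> (\<rho>\<^sup>2))"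
        by (simp add: w_def)
      moreover have "w \<rho> = 0"
        using True by (simp add: w_def)
      ultimately show ?thesis
        using True unfolding ind by (simp add: indicator_def)
    next
      case False
      \<comment> \<open>At \<rho> = 0, where the two halves overlap, \<open>w\<close> vanishes
        through the exponent \<open>Suc K\<close>.\<close>
      have "w (- \<rho>) = 0"
        using False by (cases "\<rho> = 0") (auto simp: w_def)
      then show ?thesis
        using False unfolding ind by (simp add: w_def indicator_def)
    qed
  qed
  finally have main: "has_bochner_integral lborel (\<lambda>\<rho>. \<bar>\<rho>\<bar> * \<rho> ^ K * (indicator {0..1} (\<rho>\<^sup>2) * \<Phi> (\<rho>\<^sup>2)))
      ((LBINT \<rho>. w \<rho>) + (-1) ^ K * (LBINT \<rho>. w \<rho>))" .
  have even: "2 * (LBINT \<rho>. w \<rho>) = (LBINT t:{0..1}. t ^ M * \<Phi> t)" if "K = 2 * M" for M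
  proof -
    have "set_integrable lborel {0..1} (\<lambda>t. t ^ M * \<Phi> t)"
      using int_mult[OF assms, of M] by (simp add: set_integrable_def)
    then have "(LBINT t:{0..1}. t ^ M * \<Phi> t) = (LBINT \<rho>:{0..1}. (\<rho>\<^sup>2) ^ M * \<Phi> (\<rho>\<^sup>2) * (2 * \<rho>))"
      by (rule sub(2))
    also have "\<dots> = (LBINT \<rho>. 2 * w \<rho>)"
      unfolding set_lebesgue_integral_def
      by (rule Bochner_Integration.integral_cong) (auto simp: w_def that power_mult)
    finally show ?thesis by simp
  qed
  show thesis
    by (rule that[OF main]) (use even in auto)
qed

text \<open>The integral is an angular times a radial one. Different frequencies of equal parity
  make the angular factor 0, those of opposite parity the radial factor.\<close>

lemma disk_integral:
  fixes \<Phi> :: "real \<Rightarrow> real" and \<nu> \<eta> M M' :: nat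
  assumes \<Phi>: "set_integrable lborel {0..1} \<Phi>"
    and \<nu>: "\<nu> \<in> {1, 2}" "\<eta> \<in> {1, 2}" "\<nu> = 2 \<longrightarrow> M \<noteq> 0"
  defines "F \<equiv> \<lambda>p. \<Phi> ((rho p)\<^sup>2) * harmY \<nu> M p * harmY \<eta> M' p"
  shows "set_integrable lborel unit_disk F"
    and "\<nu> \<noteq> \<eta> \<or> M \<noteq> M' \<Longrightarrow> (LINT p:unit_disk|lborel. F p) = 0"
    and "\<nu> = \<eta> \<Longrightarrow> M = M' \<Longrightarrow>
      (LINT p:unit_disk|lborel. F p) = harmY_norm2 \<nu> M / 2 * (LBINT t:{0..1}. t ^ M * \<Phi> t)"
proof -
  obtain c where c: "has_bochner_integral lborel (\<lambda>s. angularY \<nu> M (arctan s) * angularY \<eta> M' (arctan s) / (1 + s\<^sup>2)) c"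
    and c0: "\<nu> \<noteq> \<eta> \<or> (even (M + M') \<and> M \<noteq> M') \<longrightarrow> c = 0"
    and c1: "\<nu> = \<eta> \<and> M = M' \<longrightarrow> c = harmY_norm2 \<nu> M / 2"
    by (rule has_bochner_integral_angular[OF \<nu>, of M']) (rule that)
  obtain d where d: "has_bochner_integral lborel
      (\<lambda>\<rho>. \<bar>\<rho>\<bar> * \<rho> ^ (M + M') * (indicator {0..1} (\<rho>\<^sup>2) * \<Phi> (\<rho>\<^sup>2))) d"
    and d0: "odd (M + M') \<longrightarrow> d = 0"
    and d1: "\<forall>L. M + M' = 2 * L \<longrightarrow> d = (LBINT t:{0..1}. t ^ L * \<Phi> t)"
    by (rule has_bochner_integral_radial[OF \<Phi>, of "M + M'"]) (rule that)
  \<comment> \<open>Cutting \<Phi> off outside [0,1] gives a function measurable on the whole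
    line.\<close>
  define \<Psi> where "\<Psi> t = indicator {0..1} t * \<Phi> t" for t
  have \<Psi> [measurable]: "\<Psi> \<in> borel_measurable borel"
    using \<Phi> by (auto simp: \<Psi>_def [abs_def] set_integrable_def)
  have rho_sq: "(rho p)\<^sup>2 = (fst p)\<^sup>2 + (snd p)\<^sup>2" for p
    by (simp add: rho_def cmod_def)
  have [measurable]: "(\<lambda>p. (rho p)\<^sup>2) \<in> borel_measurable (borel :: (real \<times> real) measure)"
    unfolding rho_sq by (intro borel_measurable_continuous_onI continuous_intros)
  \<comment> \<open>\<open>Arg\<close> is discontinuous, so measurability comes from the continuous
    powers of x + i y.\<close>
  have [measurable]: "harmY \<nu> M \<in> borel_measurable borel" for \<nu> M
  proof -
    have "harmY \<nu> M = (\<lambda>p. if \<nu> = 1 then Re (Complex (fst p) (snd p) ^ M) else Im (Complex (fst p) (snd p) ^ M))"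
      using harmY_Complex[of \<nu> M] by (auto simp: fun_eq_iff)
    moreover have "continuous_on UNIV (\<lambda>p :: real \<times> real. Complex (fst p) (snd p) ^ M)"
      unfolding Complex_eq by (intro continuous_intros)
    ultimately show ?thesis
      by (cases "\<nu> = 1") (simp_all add: borel_measurable_continuous_onI continuous_on_Re continuous_on_Im)
  qed
  define g where "g p = \<Psi> ((rho p)\<^sup>2) * harmY \<nu> M p * harmY \<eta> M' p" for p
  have g_eq: "(\<lambda>p. indicator unit_disk p *\<^sub>R F p) = g"
    by (auto simp: fun_eq_iff g_def F_def \<Psi>_def rho_sq unit_disk_def indicator_def)
  have "has_bochner_integral lborel g (c * d)"
  proof (rule has_bochner_integral_polar_product[OF _ _ c d])
    show "g \<in> borel_measurable borel"
      unfolding g_def [abs_def] by measurable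
    fix s \<rho> :: real
    have "(rho (\<rho> * cos (arctan s), \<rho> * sin (arctan s)))\<^sup>2 = \<rho>\<^sup>2"
      by (simp add: rho_sq power_mult_distrib distrib_left [symmetric])
    then show "g (\<rho> * cos (arctan s), \<rho> * sin (arctan s)) * \<bar>\<rho>\<bar> / (1 + s\<^sup>2)
        = angularY \<nu> M (arctan s) * angularY \<eta> M' (arctan s) / (1 + s\<^sup>2) * (\<bar>\<rho>\<bar> * \<rho> ^ (M + M') * (indicator {0..1} (\<rho>\<^sup>2) * \<Phi> (\<rho>\<^sup>2)))"
      unfolding g_def harmY_polar by (simp add: angularY_def \<Psi>_def power_add)
  qed
  then have int: "set_integrable lborel unit_disk F" and val: "(LINT p:unit_disk|lborel. F p) = c * d"
    unfolding set_integrable_def set_lebesgue_integral_def g_eq by (auto simp: has_bochner_integral_iff)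
  show "set_integrable lborel unit_disk F" by (rule int)
  show "(LINT p:unit_disk|lborel. F p) = 0" if "\<nu> \<noteq> \<eta> \<or> M \<noteq> M'"
    using that c0 d0 val by fastforce
  show "(LINT p:unit_disk|lborel. F p) = harmY_norm2 \<nu> M / 2 * (LBINT t:{0..1}. t ^ M * \<Phi> t)"
    if "\<nu> = \<eta>" "M = M'"
    using that c1 d1[rule_format, of M] val by simp
qed

section \<open>Biorthogonality on the disk\<close>

lemma one_minus_rho_sq: "1 - (fst p)\<^sup>2 - (snd p)\<^sup>2 = 1 - (rho p)\<^sup>2"
  by (simp add: rho_def cmod_def)

context jp_exponents
begin

lemma jp_typeI_degree:
  "l \<in> {1..r} \<Longrightarrow> jp_typeI r \<mu> M k l = 0 \<or> degree (jp_typeI r \<mu> M k l) < k l"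
  using is_jp_typeI_jp_typeI[of M k] by (simp add: is_jp_typeI_iff)

lemma poly_weights_integral:
  "has_bochner_integral lborel
     (\<lambda>t. indicator {0..1} t *\<^sub>R (\<Sum>l=1..r. poly (p l) t * (1 - t) powr \<mu> l))
     (\<Sum>l=1..r. pow_moment (\<mu> l) (flip (p l)))"
proof -
  have "has_bochner_integral lborel (\<lambda>t. indicator {0..1} t *\<^sub>R (poly (p l) t * (1 - t) powr \<mu> l))
      (pow_moment (\<mu> l) (flip (p l)))" if "l \<in> {1..r}" for l
    using one_minus_powr_poly_integral[OF exponent_gt[OF that], of "p l"]
    by (simp add: has_bochner_integral_iff set_integrable_def set_lebesgue_integral_def)
  then show ?thesis
    unfolding scaleR_sum_right by (rule has_bochner_integral_sum)
qed

text \<open>The factor t^M left by the two harmonics becomes part of the Jacobi weight.\<close>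

lemma integral_typeI_typeII:
  fixes p :: "real poly" and c :: "nat \<Rightarrow> real" and M :: nat and k :: "nat \<Rightarrow> nat"
  defines "A \<equiv> jp_typeI r \<mu> M k"
  shows "(LBINT t:{0..1}. t ^ M * (\<Sum>l=1..r. poly (smult (c l) (p * A l)) t * (1 - t) powr \<mu> l))
    = (\<Sum>l=1..r. c l * pow_moment (\<mu> l) (flip (A l * (monom 1 M * p))))"
proof -
  have "(LBINT t:{0..1}. t ^ M * (\<Sum>l=1..r. poly (smult (c l) (p * A l)) t * (1 - t) powr \<mu> l))
      = (LBINT t:{0..1}. \<Sum>l=1..r. poly (smult (c l) (A l * (monom 1 M * p))) t * (1 - t) powr \<mu> l)"
    by (simp add: sum_distrib_left poly_monom mult_ac)
  also have "\<dots> = (\<Sum>l=1..r. c l * pow_moment (\<mu> l) (flip (A l * (monom 1 M * p))))"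
    using poly_weights_integral[of "\<lambda>l. smult (c l) (A l * (monom 1 M * p))"]
    unfolding set_lebesgue_integral_def pcompose_smult pow_moment_smult
    by (rule has_bochner_integral_integral_eq)
  finally show ?thesis .
qed

text \<open>Each summand vanishes separately, because a nonzero A l has degree below k l \<le> j l,
  within the orthogonality of the Type II polynomial; so the constants may be arbitrary.\<close>

lemma integral_typeII_typeI_zero:
  assumes "\<forall>l\<in>{1..r}. k l \<le> j l"
  shows "(\<Sum>l=1..r. c l * pow_moment (\<mu> l)
    (flip (jp_typeI r \<mu> M k l * (monom 1 M * smult b (jp_typeII r \<mu> M j))))) = 0"
proof (rule sum.neutral, rule ballI)
  fix l assume l: "l \<in> {1..r}"
  have "jp_typeI r \<mu> M k l = 0 \<or> degree (jp_typeI r \<mu> M k l) < j l"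
    using jp_typeI_degree[OF l, of M k] assms l by force
  then show "c l * pow_moment (\<mu> l)
    (flip (jp_typeI r \<mu> M k l * (monom 1 M * smult b (jp_typeII r \<mu> M j)))) = 0"
    using jp_typeII_orthogonal[OF l] by (simp only: mult_smult_right pcompose_smult pow_moment_smult mult_zero_right)
qed

text \<open>Here the sum over l enters as a whole, with all constants equal to 1, as in the Type I
  conditions.\<close>

lemma integral_typeI_eq_coeff:
  assumes "degree p < mi_size r k"
  shows "(\<Sum>l=1..r. pow_moment (\<mu> l) (flip (jp_typeI r \<mu> M k l * (monom 1 M * p))))
    = coeff p (mi_size r k - 1)"
proof -
  have "(\<Sum>l=1..r. pow_moment (\<mu> l) (flip (jp_typeI r \<mu> M k l * (monom 1 M * p))))
      = typeI_functional k (jp_typeI r \<mu> M k) (flip p * [:1, -1:] ^ M)"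
    unfolding typeI_functional_def
  proof (rule sum.cong)
    fix l assume l: "l \<in> {1..r}"
    have "flip (jp_typeI r \<mu> M k l * (monom 1 M * p))
        = flip (jp_typeI r \<mu> M k l) * (flip p * [:1, -1:] ^ M)"
      by (simp only: pcompose_mult flip_monom mult.commute)
    then show "pow_moment (\<mu> l) (flip (jp_typeI r \<mu> M k l * (monom 1 M * p)))
        = (\<Sum>i<k l. coeff (flip (jp_typeI r \<mu> M k l)) i
            * pow_moment (\<mu> l + real i) (flip p * [:1, -1:] ^ M))"
      by (simp only: pow_moment_flip_mult[OF jp_typeI_degree[OF l]])
  qed simp
  also have "\<dots> = coeff p (mi_size r k - 1)"
    using is_jp_typeI_jp_typeI assms by (rule typeI_functional_eq_coeff)
  finally show ?thesis .
qed

text \<open>General p and c let one statement serve both the Rodrigues polynomial with the weights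
  \<open>diskW\<close> and the monic one with the constants removed.\<close>

lemma disk_pairing:
  fixes M M' \<nu> \<eta> :: nat and k :: "nat \<Rightarrow> nat" and p :: "real poly" and c :: "nat \<Rightarrow> real"
  assumes "\<nu> \<in> {1, 2}" "\<eta> \<in> {1, 2}" "\<nu> = 2 \<longrightarrow> M \<noteq> 0"
  defines "F \<equiv> \<lambda>x. poly p ((rho x)\<^sup>2) * harmY \<nu> M x
    * (\<Sum>l=1..r. poly (jp_typeI r \<mu> M' k l) ((rho x)\<^sup>2) * harmY \<eta> M' x * (c l * (1 - (rho x)\<^sup>2) powr \<mu> l))"
  shows "set_integrable lborel unit_disk F"
    and "\<nu> \<noteq> \<eta> \<or> M \<noteq> M' \<Longrightarrow> (LINT x:unit_disk|lborel. F x) = 0"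
    and "\<nu> = \<eta> \<Longrightarrow> M = M' \<Longrightarrow> (LINT x:unit_disk|lborel. F x) = harmY_norm2 \<nu> M / 2
      * (\<Sum>l=1..r. c l * pow_moment (\<mu> l) (flip (jp_typeI r \<mu> M k l * (monom 1 M * p))))"
proof -
  define \<Phi> where "\<Phi> t = (\<Sum>l=1..r. poly (smult (c l) (p * jp_typeI r \<mu> M' k l)) t * (1 - t) powr \<mu> l)" for t
  have \<Phi>: "set_integrable lborel {0..1} \<Phi>"
    unfolding \<Phi>_def set_integrable_def using poly_weights_integral by (rule integrable.intros)
  have F: "F = (\<lambda>x. \<Phi> ((rho x)\<^sup>2) * harmY \<nu> M x * harmY \<eta> M' x)"
    by (simp add: fun_eq_iff F_def \<Phi>_def sum_distrib_left sum_distrib_right mult_ac)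
  show "set_integrable lborel unit_disk F"
    and "\<nu> \<noteq> \<eta> \<or> M \<noteq> M' \<Longrightarrow> (LINT x:unit_disk|lborel. F x) = 0"
    unfolding F by (rule disk_integral[OF \<Phi> assms(1-3)]; assumption)+
  assume eq: "\<nu> = \<eta>" "M = M'"
  show "(LINT x:unit_disk|lborel. F x) = harmY_norm2 \<nu> M / 2
      * (\<Sum>l=1..r. c l * pow_moment (\<mu> l) (flip (jp_typeI r \<mu> M k l * (monom 1 M * p))))"
    unfolding F disk_integral(3)[OF \<Phi> assms(1-3) eq] unfolding \<Phi>_def eq(2) integral_typeI_typeII ..
qed

end

text \<open>The cases |j| < |k| rest on the Type I moment conditions, whose weights carry no
  constants, and the value at |j| = |k| - 1 presupposes leading coefficient 1. They are therefore
  stated for \<open>I1\<close>; the other cases are stated for both \<open>I\<close> and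
  \<open>I1\<close>.\<close>

theorem proposition17:
  fixes r :: nat and \<mu> :: "nat \<Rightarrow> real" and n m j k :: "nat \<Rightarrow> nat" and \<nu> \<eta> :: nat
  assumes "1 \<le> r"
    and "\<And>l. l \<in> {1..r} \<Longrightarrow> \<mu> l > -1"
    and "\<And>i l. \<lbrakk>i \<in> {1..r}; l \<in> {1..r}; i \<noteq> l\<rbrakk> \<Longrightarrow> \<mu> i - \<mu> l \<notin> \<int>"
    and "\<nu> \<in> {1, 2}" and "\<eta> \<in> {1, 2}"
    and "2 * mi_size r j \<le> mi_size r n" and "2 * mi_size r k \<le> mi_size r m"
    and "\<nu> = 2 \<Longrightarrow> 2 * mi_size r j < mi_size r n"
    and "\<eta> = 2 \<Longrightarrow> 2 * mi_size r k < mi_size r m"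
  shows
    "let M = mi_size r n - 2 * mi_size r j;
         M' = mi_size r m - 2 * mi_size r k;
         F = (\<lambda>x. diskP r \<mu> n j \<nu> x * diskQ r \<mu> m k \<eta> x);
         I = (LINT x:unit_disk|lborel. F x);
         F1 = (\<lambda>x. diskP_monic r \<mu> n j \<nu> x * diskQ_normalized r \<mu> m k \<eta> x);
         I1 = (LINT x:unit_disk|lborel. F1 x)
     in set_integrable lborel unit_disk F \<and>
        (\<nu> \<noteq> \<eta> \<or> M \<noteq> M' \<longrightarrow> I = 0) \<and>
        (\<nu> = \<eta> \<and> M = M' \<longrightarrow>
           ((\<forall>l\<in>{1..r}. k l \<le> j l) \<longrightarrow> I = 0)) \<and>
        set_integrable lborel unit_disk F1 \<and>
        (\<nu> \<noteq> \<eta> \<or> M \<noteq> M' \<longrightarrow> I1 = 0) \<and>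
        (\<nu> = \<eta> \<and> M = M' \<longrightarrow>
           ((\<forall>l\<in>{1..r}. k l \<le> j l) \<longrightarrow> I1 = 0) \<and>
           (mi_size r j + 2 \<le> mi_size r k \<longrightarrow> I1 = 0) \<and>
           (mi_size r j + 1 = mi_size r k \<longrightarrow> I1 = harmY_norm2 \<nu> M / 2))"
proof -
  interpret jp_exponents r \<mu>
    by unfold_locales (fact assms(2), fact assms(3))
  define M where "M = mi_size r n - 2 * mi_size r j"
  define M' where "M' = mi_size r m - 2 * mi_size r k"
  define P where "P = jp_typeII r \<mu> M j"
  define P1 where "P1 = jp_typeII_monic r \<mu> M j"
  have P1: "P1 = smult (1 / lead_coeff P) P"
    by (simp add: P1_def P_def jp_typeII_monic_def)
  have deg: "degree P = mi_size r j"
    by (simp add: P_def degree_jp_typeII)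
  moreover have "lead_coeff P \<noteq> 0"
    by (simp add: P_def jp_typeII_nonzero)
  ultimately have deg1: "degree P1 = mi_size r j" and coeff1: "coeff P1 (mi_size r j) = 1"
    by (simp_all add: P1)
  \<comment> \<open>The strict inequality excludes M = 0, where the sine harmonic is zero.\<close>
  have \<nu>: "\<nu> = 2 \<longrightarrow> M \<noteq> 0"
    using assms(8) by (auto simp: M_def)
  have w0: "w_const (\<mu> l) \<noteq> 0" if "l \<in> {1..r}" for l
    using assms(2)[OF that] by (simp add: w_const_def)
  let ?R = "\<lambda>p c x. poly p ((rho x)\<^sup>2) * harmY \<nu> M x
    * (\<Sum>l=1..r. poly (jp_typeI r \<mu> M' k l) ((rho x)\<^sup>2) * harmY \<eta> M' x * (c l * (1 - (rho x)\<^sup>2) powr \<mu> l))"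
  have F: "(\<lambda>x. diskP r \<mu> n j \<nu> x * diskQ r \<mu> m k \<eta> x) = ?R P (\<lambda>l. w_const (\<mu> l))"
    by (simp add: fun_eq_iff diskP_def diskQ_def diskA_def diskW_def one_minus_rho_sq Let_def P_def
        flip: M_def M'_def)
  have F1: "(\<lambda>x. diskP_monic r \<mu> n j \<nu> x * diskQ_normalized r \<mu> m k \<eta> x) = ?R P1 (\<lambda>l. 1)"
    using w0 by (simp add: fun_eq_iff diskP_monic_def diskQ_normalized_def diskA_def diskW_def
        one_minus_rho_sq Let_def P1_def flip: M_def M'_def)
  note pairing = disk_pairing[OF assms(4,5) \<nu>, where M' = M' and k = k]
  have zero: "(LINT x:unit_disk|lborel. ?R (smult b P) c x) = 0"
    if "\<nu> = \<eta>" "M = M'" "\<forall>l\<in>{1..r}. k l \<le> j l" for b c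
    unfolding pairing(3)[OF that(1,2)] P_def integral_typeII_typeI_zero[OF that(3)] by simp
  \<comment> \<open>As P1 is monic of degree |j|, this coefficient is 0 if |j| \<le> |k| - 2 and 1
    if |j| = |k| - 1.\<close>
  have val: "(LINT x:unit_disk|lborel. ?R P1 (\<lambda>l. 1) x) = harmY_norm2 \<nu> M / 2 * coeff P1 (mi_size r k - 1)"
    if "\<nu> = \<eta>" "M = M'" "mi_size r j < mi_size r k"
    unfolding pairing(3)[OF that(1,2)] unfolding mult_1_left using that(3)
    by (subst integral_typeI_eq_coeff) (simp_all add: deg1)
  have "set_integrable lborel unit_disk (?R P (\<lambda>l. w_const (\<mu> l)))"
    and "set_integrable lborel unit_disk (?R P1 (\<lambda>l. 1))"
    by (rule pairing(1))+
  moreover have "(LINT x:unit_disk|lborel. ?R P (\<lambda>l. w_const (\<mu> l)) x) = 0"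
    and "(LINT x:unit_disk|lborel. ?R P1 (\<lambda>l. 1) x) = 0" if "\<nu> \<noteq> \<eta> \<or> M \<noteq> M'"
    using that by (rule pairing(2))+
  moreover have "(LINT x:unit_disk|lborel. ?R P (\<lambda>l. w_const (\<mu> l)) x) = 0"
    and "(LINT x:unit_disk|lborel. ?R P1 (\<lambda>l. 1) x) = 0"
    if "\<nu> = \<eta>" "M = M'" "\<forall>l\<in>{1..r}. k l \<le> j l"
    unfolding P1 using zero[OF that, of 1] zero[OF that] by (simp_all only: smult_1_left)
  moreover have "(LINT x:unit_disk|lborel. ?R P1 (\<lambda>l. 1) x) = 0"
    if "\<nu> = \<eta>" "M = M'" "mi_size r j + 2 \<le> mi_size r k"
    using val[OF that(1,2)] that(3) coeff_eq_0[of P1 "mi_size r k - 1"] by (simp add: deg1)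
  moreover have "(LINT x:unit_disk|lborel. ?R P1 (\<lambda>l. 1) x) = harmY_norm2 \<nu> M / 2"
    if "\<nu> = \<eta>" "M = M'" "mi_size r j + 1 = mi_size r k"
    using val[OF that(1,2)] that(3) coeff1 by (simp flip: that(3))
  ultimately show ?thesis
    unfolding Let_def F F1 M_def [symmetric] M'_def [symmetric] by blast
qed

end
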